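(* Let $\mathcal{M}$ be a unitary magma and $k\ge0$ be an integer. Then the space $\mathsf{Cro}_k\mathcal{M}=\mathsf{C}\mathcal{M}/\mathfrak{R}_{\mathsf{Cro}_k\mathcal{M}}$ is a quotient operad of $\mathsf{C}\mathcal{M}$ (that is, $\mathfrak{R}_{\mathsf{Cro}_k\mathcal{M}}$ is an operad ideal of $\mathsf{C}\mathcal{M}$) and is isomorphic to the suboperad of $\mathsf{C}\mathcal{M}$ restricted to the subspace generated by all $\mathcal{M}$-cliques with crossing numbers no greater than $k$.
   Context: Let $\mathbb{K}$ be a field of characteristic zero and $[n]=\{1,\dots,n\}$. A unitary magma is a set $\mathcal{M}$ with a binary operation $\star$ (not assumed associative) having a two-sided unit $\mathbb{1}_{\mathcal{M}}$. Operads are nonsymmetric operads in $\mathbb{K}$-vector spaces (graded from arity $1$, with partial compositions $\circ_i$ and a unit of arity $1$). An operad ideal of $\mathcal{O}$ is a graded subspace $I$ such that $x\circ_i y$ and $y\circ_j x$ are in $I$ for all $x\in\mathcal{O}$, $y\in I$ and valid $i,j$; then $\mathcal{O}/I$ is a quotient operad. A suboperad is a graded subspace containing the unit and closed under all partial compositions. An $\mathcal{M}$-clique of arity $n\ge1$ is a map $\mathfrak{p}$ assigning a label $\mathfrak{p}(x,y)\in\mathcal{M}$ to each arc $(x,y)$, $1\le x<y\le n+1$; by convention the only $\mathcal{M}$-clique of arity $1$ is $\mathbf{u}$, with $\mathbf{u}(1,2)=\mathbb{1}_{\mathcal{M}}$. The arc $(1,n+1)$ is the base; the arcs $(x,x+1)$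 different from $(1,n+1)$ are the edges; all other arcs are diagonals. An arc is solid if its label is not $\mathbb{1}_{\mathcal{M}}$. Write $\mathfrak{p}_0:=\mathfrak{p}(1,n+1)$ and $\mathfrak{p}_i:=\mathfrak{p}(i,i+1)$ for $i\in[n]$. $\mathsf{C}\mathcal{M}$ is the operad (with unit $\mathbf{u}$) such that $\mathsf{C}\mathcal{M}(n)$ has basis the $\mathcal{M}$-cliques of arity $n$, and for $\mathcal{M}$-cliques $\mathfrak{p},\mathfrak{q}$ of arities $n,m$ and $i\in[n]$, $\mathfrak{p}\circ_i\mathfrak{q}$ is the $\mathcal{M}$-clique of arity $n+m-1$ with, for $1\le x<y\le n+m$, $$(\mathfrak{p}\circ_i\mathfrak{q})(x,y)=\begin{cases}\mathfrak{p}(x,y)&\text{if }y\le i,\\ \mathfrak{p}(x,y-m+1)&\text{if }x\le i<i+m\le y,\ (x,y)\ne(i,i+m),\\ \mathfrak{p}(x-m+1,y-m+1)&\text{if }i+m\le x,\\ \mathfrak{q}(x-i+1,y-i+1)&\text{if }i\le x<y\le i+m,\ (x,y)\ne(i,i+m),\\ \mathfrak{p}_i\star\mathfrak{q}_0&\text{if }(x,y)=(i,i+m),\\ \mathbb{1}_{\mathcal{M}}&\text{otherwise}.\end{cases}$$ Two diagonals $(x,y)$ and $(x',y')$ are crossing if $x<x'<y<y'$ or $x'<x<y'<y$. The crossing number of a solid diagonal of $\mathfrak{p}$ is the number of solid diagonals of $\mathfrak{p}$ crossing it; the crossing number $\mathrm{cros}(\mathfrak{p})$ is the maximal crossing number among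 the solid diagonals of $\mathfrak{p}$ ($0$ if there are none). $\mathfrak{R}_{\mathsf{Cro}_k\mathcal{M}}$ is the subspace of $\mathsf{C}\mathcal{M}$ spanned by all $\mathcal{M}$-cliques $\mathfrak{p}$ with $\mathrm{cros}(\mathfrak{p})\ge k+1$. *)

theory Defs
  imports "HOL-Algebra.Module" "HOL-Algebra.QuotRing" "HOL-Algebra.Algebraic_Closure_Type" "HOL-Library.Poly_Mapping"
begin

section \<open>Nonsymmetric operads in vector spaces\<close>

text \<open>
  An operad is graded from arity 1: the value of \<open>component\<close> at 0 is never constrained.
  \<open>pcomp P n m i x y\<close> is the partial composition of \<open>x\<close>, of arity \<open>n\<close>, with \<open>y\<close>, of arity \<open>m\<close>,
  at the input \<open>i\<close> of \<open>x\<close>; the arities are arguments because the same element of the carrier type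
  may occur in several components. The multiplicative fields of the module
  records play no role.
\<close>

record ('k, 'a) ns_operad =
  component :: "nat \<Rightarrow> ('k, 'a) module"
  pcomp :: "nat \<Rightarrow> nat \<Rightarrow> nat \<Rightarrow> 'a \<Rightarrow> 'a \<Rightarrow> 'a"
  ounit :: "'a"

abbreviation elems :: "('k, 'a, 'z) ns_operad_scheme \<Rightarrow> nat \<Rightarrow> 'a set"
  where "elems P n \<equiv> carrier (component P n)"

definition linear_map ::
    "('k, 'r) ring_scheme \<Rightarrow> ('k, 'a, 'u) module_scheme \<Rightarrow> ('k, 'b, 'v) module_scheme \<Rightarrow> ('a \<Rightarrow> 'b) \<Rightarrow> bool"
  where "linear_map K V W f \<longleftrightarrow>
    f \<in> carrier V \<rightarrow> carrier W \<and>
    (\<forall>x\<in>carrier V. \<forall>y\<in>carrier V. f (x \<oplus>\<^bsub>V\<^esub> y) = f x \<oplus>\<^bsub>W\<^esub> f y) \<and>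
    (\<forall>a\<in>carrier K. \<forall>x\<in>carrier V. f (a \<odot>\<^bsub>V\<^esub> x) = a \<odot>\<^bsub>W\<^esub> f x)"

locale ns_operad = field K for K :: "('k, 'r) ring_scheme" (structure) and P :: "('k, 'a, 'z) ns_operad_scheme" (structure) +
  assumes component_module: "1 \<le> n \<Longrightarrow> module K (component P n)"
    and pcomp_linear_left: "\<lbrakk>1 \<le> n; 1 \<le> m; i \<in> {1..n}; y \<in> elems P m\<rbrakk> \<Longrightarrow>
      linear_map K (component P n) (component P (n + m - 1)) (\<lambda>x. pcomp P n m i x y)"
    and pcomp_linear_right: "\<lbrakk>1 \<le> n; 1 \<le> m; i \<in> {1..n}; x \<in> elems P n\<rbrakk> \<Longrightarrow>
      linear_map K (component P m) (component P (n + m - 1)) (\<lambda>y. pcomp P n m i x y)"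
    and unit_closed: "ounit P \<in> elems P 1"
    and unit_left: "\<lbrakk>1 \<le> m; y \<in> elems P m\<rbrakk> \<Longrightarrow> pcomp P 1 m 1 (ounit P) y = y"
    and unit_right: "\<lbrakk>1 \<le> n; i \<in> {1..n}; x \<in> elems P n\<rbrakk> \<Longrightarrow> pcomp P n 1 i x (ounit P) = x"
    and assoc_sequential:
      "\<lbrakk>1 \<le> n; 1 \<le> m; 1 \<le> l; i \<in> {1..n}; j \<in> {1..m};
        x \<in> elems P n; y \<in> elems P m; z \<in> elems P l\<rbrakk> \<Longrightarrow>
       pcomp P (n + m - 1) l (i + j - 1) (pcomp P n m i x y) z =
       pcomp P n (m + l - 1) i x (pcomp P m l j y z)"
    and assoc_parallel:
      "\<lbrakk>1 \<le> n; 1 \<le> m; 1 \<le> l; i \<in> {1..n}; j \<in> {1..n}; i < j;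
        x \<in> elems P n; y \<in> elems P m; z \<in> elems P l\<rbrakk> \<Longrightarrow>
       pcomp P (n + m - 1) l (j + m - 1) (pcomp P n m i x y) z =
       pcomp P (n + l - 1) m i (pcomp P n l j x z) y"

locale operad_ideal = ns_operad K P
  for K :: "('k, 'r) ring_scheme" (structure) and P :: "('k, 'a, 'z) ns_operad_scheme" (structure) and I :: "nat \<Rightarrow> 'a set" +
  assumes ideal_submodule: "1 \<le> n \<Longrightarrow> submodule (I n) K (component P n)"
    and ideal_right: "\<lbrakk>1 \<le> n; 1 \<le> m; i \<in> {1..n}; x \<in> elems P n; y \<in> I m\<rbrakk> \<Longrightarrow>
      pcomp P n m i x y \<in> I (n + m - 1)"
    and ideal_left: "\<lbrakk>1 \<le> n; 1 \<le> m; j \<in> {1..m}; x \<in> elems P n; y \<in> I m\<rbrakk> \<Longrightarrow>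
      pcomp P m n j y x \<in> I (m + n - 1)"

locale suboperad = ns_operad K P
  for K :: "('k, 'r) ring_scheme" (structure) and P :: "('k, 'a, 'z) ns_operad_scheme" (structure) and S :: "nat \<Rightarrow> 'a set" +
  assumes sub_submodule: "1 \<le> n \<Longrightarrow> submodule (S n) K (component P n)"
    and sub_unit: "ounit P \<in> S 1"
    and sub_pcomp: "\<lbrakk>1 \<le> n; 1 \<le> m; i \<in> {1..n}; x \<in> S n; y \<in> S m\<rbrakk> \<Longrightarrow>
      pcomp P n m i x y \<in> S (n + m - 1)"

definition restrict_operad ::
    "('k, 'a) ns_operad \<Rightarrow> (nat \<Rightarrow> 'a set) \<Rightarrow> ('k, 'a) ns_operad"
  where "restrict_operad P S = P\<lparr>component := \<lambda>n. (component P n)\<lparr>carrier := S n\<rparr>\<rparr>"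

text \<open>
  As for quotient rings, the operations are evaluated on all representatives; for the scalar
  multiplication it would not be enough to scale a coset elementwise, since \<open>0 \<cdot> A\<close> has to be \<open>W\<close>.
\<close>

definition quotient_module :: "('k, 'a) module \<Rightarrow> 'a set \<Rightarrow> ('k, 'a set) module"
  where "quotient_module V W =
    \<lparr>carrier = a_rcosets\<^bsub>V\<^esub> W, monoid.mult = undefined, one = undefined, zero = W, add = set_add V,
     module.smult = \<lambda>a A. \<Union>x\<in>A. W +>\<^bsub>V\<^esub> (a \<odot>\<^bsub>V\<^esub> x)\<rparr>"

definition quotient_operad ::
    "('k, 'a) ns_operad \<Rightarrow> (nat \<Rightarrow> 'a set) \<Rightarrow> ('k, 'a set) ns_operad"
  where "quotient_operad P I =
    \<lparr>component = \<lambda>n. quotient_module (component P n) (I n),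
     pcomp = \<lambda>n m i A B. \<Union>x\<in>A. \<Union>y\<in>B. I (n + m - 1) +>\<^bsub>component P (n + m - 1)\<^esub> pcomp P n m i x y,
     ounit = I 1 +>\<^bsub>component P 1\<^esub> ounit P\<rparr>"

definition operad_iso ::
    "('k, 'r) ring_scheme \<Rightarrow> ('k, 'a, 'u) ns_operad_scheme \<Rightarrow> ('k, 'b, 'v) ns_operad_scheme \<Rightarrow>
     (nat \<Rightarrow> 'a \<Rightarrow> 'b) \<Rightarrow> bool"
  where "operad_iso K P Q \<phi> \<longleftrightarrow>
    (\<forall>n\<ge>1. linear_map K (component P n) (component Q n) (\<phi> n) \<and>
            bij_betw (\<phi> n) (elems P n) (elems Q n)) \<and>
    \<phi> 1 (ounit P) = ounit Q \<and>
    (\<forall>n\<ge>1. \<forall>m\<ge>1. \<forall>i\<in>{1..n}. \<forall>x\<in>elems P n. \<forall>y\<in>elems P m.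
       \<phi> (n + m - 1) (pcomp P n m i x y) = pcomp Q n m i (\<phi> n x) (\<phi> m y))"

definition operads_isomorphic ::
    "('k, 'r) ring_scheme \<Rightarrow> ('k, 'a, 'u) ns_operad_scheme \<Rightarrow> ('k, 'b, 'v) ns_operad_scheme \<Rightarrow> bool"
  where "operads_isomorphic K P Q \<longleftrightarrow> ns_operad K P \<and> ns_operad K Q \<and> (\<exists>\<phi>. operad_iso K P Q \<phi>)"

definition linear_span :: "('k, 'r) ring_scheme \<Rightarrow> ('k, 'a, 'u) module_scheme \<Rightarrow> 'a set \<Rightarrow> 'a set"
  where "linear_span K V B = (\<lambda>W. submodule W K V) hull B"


section \<open>Decorated cliques\<close>

locale unitary_magma =
  fixes M :: "('m, 'z) monoid_scheme" (structure)
  assumes m_closed: "\<lbrakk>x \<in> carrier M; y \<in> carrier M\<rbrakk> \<Longrightarrow> x \<otimes> y \<in> carrier M"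
    and one_closed: "\<one> \<in> carrier M"
    and l_one: "x \<in> carrier M \<Longrightarrow> \<one> \<otimes> x = x"
    and r_one: "x \<in> carrier M \<Longrightarrow> x \<otimes> \<one> = x"

type_synonym arc = "nat \<times> nat"
type_synonym 'm clique = "arc \<Rightarrow> 'm"

definition arcs :: "nat \<Rightarrow> arc set"
  where "arcs n = {(x, y). 1 \<le> x \<and> x < y \<and> y \<le> n + 1}"

definition cliques :: "('m, 'z) monoid_scheme \<Rightarrow> nat \<Rightarrow> 'm clique set"
  where "cliques M n = {p \<in> arcs n \<rightarrow>\<^sub>E carrier M. n = 1 \<longrightarrow> p (1, 2) = \<one>\<^bsub>M\<^esub>}"

definition unit_clique :: "('m, 'z) monoid_scheme \<Rightarrow> 'm clique"
  where "unit_clique M = (\<lambda>a\<in>arcs 1. \<one>\<^bsub>M\<^esub>)"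

definition clique_comp ::
    "('m, 'z) monoid_scheme \<Rightarrow> nat \<Rightarrow> nat \<Rightarrow> nat \<Rightarrow> 'm clique \<Rightarrow> 'm clique \<Rightarrow> 'm clique"
  where "clique_comp M n m i p q = (\<lambda>(x, y)\<in>arcs (n + m - 1).
    if y \<le> i then p (x, y)
    else if x \<le> i \<and> i + m \<le> y \<and> (x, y) \<noteq> (i, i + m) then p (x, y - m + 1)
    else if i + m \<le> x then p (x - m + 1, y - m + 1)
    else if i \<le> x \<and> y \<le> i + m \<and> (x, y) \<noteq> (i, i + m) then q (x - i + 1, y - i + 1)
    else if (x, y) = (i, i + m) then p (i, i + 1) \<otimes>\<^bsub>M\<^esub> q (1, m + 1)
    else \<one>\<^bsub>M\<^esub>)"

definition edges :: "nat \<Rightarrow> arc set"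
  where "edges n = {(x, y) \<in> arcs n. y = x + 1 \<and> (x, y) \<noteq> (1, n + 1)}"

definition diagonals :: "nat \<Rightarrow> arc set"
  where "diagonals n = arcs n - edges n - {(1, n + 1)}"

definition solid_diagonals :: "('m, 'z) monoid_scheme \<Rightarrow> nat \<Rightarrow> 'm clique \<Rightarrow> arc set"
  where "solid_diagonals M n p = {d \<in> diagonals n. p d \<noteq> \<one>\<^bsub>M\<^esub>}"

fun crossing :: "arc \<Rightarrow> arc \<Rightarrow> bool"
  where "crossing (x, y) (x', y') \<longleftrightarrow>
    (x < x' \<and> x' < y \<and> y < y') \<or> (x' < x \<and> x < y' \<and> y' < y)"

definition crossing_number :: "('m, 'z) monoid_scheme \<Rightarrow> nat \<Rightarrow> 'm clique \<Rightarrow> arc \<Rightarrow> nat"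
  where "crossing_number M n p d = card {d' \<in> solid_diagonals M n p. crossing d d'}"

definition cros :: "('m, 'z) monoid_scheme \<Rightarrow> nat \<Rightarrow> 'm clique \<Rightarrow> nat"
  where "cros M n p =
    (if solid_diagonals M n p = {} then 0
     else Max (crossing_number M n p ` solid_diagonals M n p))"


section \<open>The operad of cliques and the quotients by crossing numbers\<close>

text \<open>
  The scalars are the elements of a type of class \<^class>\<open>field\<close>, seen as an algebraic structure
  through \<^const>\<open>ring_of_type_algebra\<close>. The formal linear combinations of cliques of arity
  \<open>n\<close> are the finitely supported functions whose support consists of cliques of arity \<open>n\<close>.
\<close>

definition clique_module ::
    "('m, 'z) monoid_scheme \<Rightarrow> nat \<Rightarrow> ('k::field, 'm clique \<Rightarrow>\<^sub>0 'k) module"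
  where "clique_module M n =
    \<lparr>carrier = {f. Poly_Mapping.keys f \<subseteq> cliques M n}, monoid.mult = undefined, one = undefined,
     zero = 0, add = (+), module.smult = \<lambda>c. Poly_Mapping.map ((*) c)\<rparr>"

abbreviation clique_vec :: "'m clique \<Rightarrow> ('m clique \<Rightarrow>\<^sub>0 'k::field)"
  where "clique_vec p \<equiv> Poly_Mapping.single p 1"

definition clique_operad :: "('m, 'z) monoid_scheme \<Rightarrow> ('k::field, 'm clique \<Rightarrow>\<^sub>0 'k) ns_operad"
  where "clique_operad M =
    \<lparr>component = clique_module M,
     pcomp = \<lambda>n m i f g. \<Sum>p\<in>Poly_Mapping.keys f. \<Sum>q\<in>Poly_Mapping.keys g.
       Poly_Mapping.single (clique_comp M n m i p q)
         (Poly_Mapping.lookup f p * Poly_Mapping.lookup g q),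
     ounit = clique_vec (unit_clique M)\<rparr>"

definition Cro_ideal :: "('m, 'z) monoid_scheme \<Rightarrow> nat \<Rightarrow> nat \<Rightarrow> ('m clique \<Rightarrow>\<^sub>0 'k::field) set"
  where "Cro_ideal M k n = linear_span ring_of_type_algebra (clique_module M n)
    (clique_vec ` {p \<in> cliques M n. k + 1 \<le> cros M n p})"

definition Cro :: "('m, 'z) monoid_scheme \<Rightarrow> nat \<Rightarrow> ('k::field, ('m clique \<Rightarrow>\<^sub>0 'k) set) ns_operad"
  where "Cro M k = quotient_operad (clique_operad M) (Cro_ideal M k)"

definition low_crossing_span ::
    "('m, 'z) monoid_scheme \<Rightarrow> nat \<Rightarrow> nat \<Rightarrow> ('m clique \<Rightarrow>\<^sub>0 'k::field) set"
  where "low_crossing_span M k n = linear_span ring_of_type_algebra (clique_module M n)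
    (clique_vec ` {p \<in> cliques M n. cros M n p \<le> k})"

end

theory Submission
  imports Defs
begin

text \<open>
  The argument rests on one identity: for the composite of two cliques,
  \<open>cros (p \<circ>\<^sub>i q) = max (cros p) (cros q)\<close> (lemma \<open>cros_clique_comp\<close>).
  The arcs of the composite are of four kinds: translates of the arcs of \<open>p\<close> other than its
  \<open>i\<close>-th edge, translates of the arcs of \<open>q\<close> other than its base, the arc \<open>(i, i + m)\<close>
  along which the two polygons are glued, and the arcs crossing that one
  (\<open>composite_arc_cases\<close>). Arcs of the last kind are never solid. Hence nothing solid crosses
  \<open>(i, i + m)\<close>, no translate from \<open>p\<close> crosses a translate from \<open>q\<close>, and, both translations
  preserving crossings, every solid diagonal keeps its crossing number.

  It follows that the span of the cliques with \<open>cros \<ge> k + 1\<close> is an ideal, since the maximum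
  exceeds \<open>k\<close> as soon as one of its arguments does, and that the span of the cliques with
  \<open>cros \<le> k\<close> is a suboperad, since the maximum is at most \<open>k\<close> when both arguments are. In each
  arity these two spans are complementary, being generated by complementary parts of a basis.
  Whenever an operad is the direct sum of an ideal and a suboperad, the projection identifies the
  suboperad with the quotient (\<open>quotient_isomorphic_complement\<close>). This uses that the quotient of
  an operad by an ideal is an operad (\<open>ns_operad_quotient\<close>), which holds because each axiom
  passes from representatives to cosets.

  That the cliques form an operad at all is the bilinear extension of the corresponding identities
  for single cliques. The two associativity laws (\<open>clique_comp_sequential\<close> and
  \<open>clique_comp_parallel\<close>) come from the same four kinds of arcs, applied to both levels of a
  nested composite; the magma operation is never applied twice in a row to nontrivial labels, so its
  associativity is not needed.
\<close>

section \<open>Restrictions and quotients of operads\<close>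

lemma linear_mapI:
  assumes "\<And>x. x \<in> carrier V \<Longrightarrow> f x \<in> carrier W"
    and "\<And>x y. \<lbrakk>x \<in> carrier V; y \<in> carrier V\<rbrakk> \<Longrightarrow> f (x \<oplus>\<^bsub>V\<^esub> y) = f x \<oplus>\<^bsub>W\<^esub> f y"
    and "\<And>a x. \<lbrakk>a \<in> carrier K; x \<in> carrier V\<rbrakk> \<Longrightarrow> f (a \<odot>\<^bsub>V\<^esub> x) = a \<odot>\<^bsub>W\<^esub> f x"
  shows "linear_map K V W f"
  using assms by (auto simp: linear_map_def)

lemma linear_mapD:
  assumes "linear_map K V W f"
  shows "x \<in> carrier V \<Longrightarrow> f x \<in> carrier W"
    and "\<lbrakk>x \<in> carrier V; y \<in> carrier V\<rbrakk> \<Longrightarrow> f (x \<oplus>\<^bsub>V\<^esub> y) = f x \<oplus>\<^bsub>W\<^esub> f y"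
    and "\<lbrakk>a \<in> carrier K; x \<in> carrier V\<rbrakk> \<Longrightarrow> f (a \<odot>\<^bsub>V\<^esub> x) = a \<odot>\<^bsub>W\<^esub> f x"
  using assms by (auto simp: linear_map_def)

lemma (in ns_operad) pcomp_closed:
  assumes "1 \<le> n" "1 \<le> m" "i \<in> {1..n}" "x \<in> elems P n" "y \<in> elems P m"
  shows "pcomp P n m i x y \<in> elems P (n + m - 1)"
  using linear_mapD(1)[OF pcomp_linear_left] assms by blast

lemma restrict_operad_simps [simp]:
  "elems (restrict_operad P S) n = S n"
  "component (restrict_operad P S) n = (component P n)\<lparr>carrier := S n\<rparr>"
  "pcomp (restrict_operad P S) = pcomp P"
  "ounit (restrict_operad P S) = ounit P"
  by (simp_all add: restrict_operad_def)

lemma ns_operad_restrict: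
  assumes "suboperad K P S"
  shows "ns_operad K (restrict_operad P S)"
proof -
  interpret suboperad K P S by fact
  have sub: "S n \<subseteq> elems P n" if "1 \<le> n" for n
    using module.submoduleE(1)[OF component_module sub_submodule] that by blast
  then have subD: "\<lbrakk>1 \<le> n; x \<in> S n\<rbrakk> \<Longrightarrow> x \<in> elems P n" for n x
    by blast
  show ?thesis
  proof (intro ns_operad.intro ns_operad_axioms.intro)
    show "field K"
      by (rule field_axioms)
  next
    fix n :: nat assume "1 \<le> n"
    then show "module K (component (restrict_operad P S) n)"
      using submodule.submodule_is_module[OF sub_submodule component_module] by simp
  next
    fix n m i :: nat and y
    assume *: "1 \<le> n" "1 \<le> m" "i \<in> {1..n}" "y \<in> elems (restrict_operad P S) m"
    then have "linear_map K (component P n) (component P (n + m - 1)) (\<lambda>x. pcomp P n m i x y)"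
      using sub by (intro pcomp_linear_left) auto
    then show "linear_map K (component (restrict_operad P S) n)
        (component (restrict_operad P S) (n + m - 1))
        (\<lambda>x. pcomp (restrict_operad P S) n m i x y)"
      using * sub sub_pcomp by (auto simp: linear_map_def subset_iff)
  next
    fix n m i :: nat and x
    assume *: "1 \<le> n" "1 \<le> m" "i \<in> {1..n}" "x \<in> elems (restrict_operad P S) n"
    then have "x \<in> elems P n"
      using subD by simp
    with * have "linear_map K (component P m) (component P (n + m - 1)) (\<lambda>y. pcomp P n m i x y)"
      using sub by (intro pcomp_linear_right) auto
    then show "linear_map K (component (restrict_operad P S) m)
        (component (restrict_operad P S) (n + m - 1))
        (\<lambda>y. pcomp (restrict_operad P S) n m i x y)"
      using * sub sub_pcomp by (auto simp: linear_map_def subset_iff)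
  qed (simp_all only: restrict_operad_simps(1,3,4) sub_unit,
      (rule unit_left unit_right assoc_sequential assoc_parallel; simp only: subD)+)
qed

lemma submodule_imp_abelian_subgroup:
  assumes "module K V" "submodule W K V"
  shows "abelian_subgroup W V"
  using assms
  by (intro abelian_subgroupI3 additive_subgroup.intro) (auto simp: module_def submodule_def)

lemma quotient_module_simps [simp]:
  "carrier (quotient_module V W) = a_rcosets\<^bsub>V\<^esub> W"
  "zero (quotient_module V W) = W"
  "add (quotient_module V W) = set_add V"
  "module.smult (quotient_module V W) a A = (\<Union>x\<in>A. W +>\<^bsub>V\<^esub> (a \<odot>\<^bsub>V\<^esub> x))"
  by (simp_all add: quotient_module_def)

lemma a_rcosets_cases:
  assumes "A \<in> a_rcosets\<^bsub>V\<^esub> W"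
  obtains x where "x \<in> carrier V" "A = W +>\<^bsub>V\<^esub> x"
  using assms by (auto simp: A_RCOSETS_def')

text \<open>The union defining the scalar multiplication of cosets runs over equal cosets, because
  \<open>a \<odot> (w \<oplus> x)\<close> and \<open>a \<odot> x\<close> differ by the element \<open>a \<odot> w\<close> of \<open>W\<close>.\<close>

lemma quotient_smult_coset:
  assumes V: "module K V" and W: "submodule W K V"
    and a: "a \<in> carrier K" and x: "x \<in> carrier V"
  shows "module.smult (quotient_module V W) a (W +>\<^bsub>V\<^esub> x) = W +>\<^bsub>V\<^esub> (a \<odot>\<^bsub>V\<^esub> x)"
proof -
  interpret module K V by fact
  interpret W: abelian_subgroup W V by (rule submodule_imp_abelian_subgroup) fact+
  have "W +>\<^bsub>V\<^esub> (a \<odot>\<^bsub>V\<^esub> y) = W +>\<^bsub>V\<^esub> (a \<odot>\<^bsub>V\<^esub> x)" if y: "y \<in> W +>\<^bsub>V\<^esub> x" for y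
  proof -
    obtain w where w: "w \<in> W" "y = w \<oplus>\<^bsub>V\<^esub> x"
      using y by (auto simp: a_r_coset_def')
    then have "a \<odot>\<^bsub>V\<^esub> y = a \<odot>\<^bsub>V\<^esub> w \<oplus>\<^bsub>V\<^esub> a \<odot>\<^bsub>V\<^esub> x"
      using a x smult_r_distr W.a_subset by blast
    moreover have "a \<odot>\<^bsub>V\<^esub> w \<in> W"
      using submoduleE(4)[OF W] a w by blast
    ultimately have "a \<odot>\<^bsub>V\<^esub> y \<in> W +>\<^bsub>V\<^esub> (a \<odot>\<^bsub>V\<^esub> x)"
      by (auto simp: a_r_coset_def')
    then show ?thesis
      using W.a_repr_independence' a x by auto
  qed
  moreover have "x \<in> W +>\<^bsub>V\<^esub> x"
    using x by (rule W.a_rcos_self)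
  ultimately show ?thesis
    unfolding quotient_module_simps(4) by (intro UN_constant_eq ballI)
qed

lemma coset_linear_map:
  assumes V: "module K V" and W: "submodule W K V"
  shows "linear_map K V (quotient_module V W) (\<lambda>x. W +>\<^bsub>V\<^esub> x)"
proof -
  interpret module K V by fact
  interpret W: abelian_subgroup W V by (rule submodule_imp_abelian_subgroup) fact+
  show ?thesis
    by (intro linear_mapI)
      (simp_all only: quotient_module_simps(1,3) quotient_smult_coset[OF V W] W.a_rcos_sum
        a_rcosetsI W.a_subset)
qed

text \<open>The additive monoid of a ring or module record comes with an arbitrary record extension,
  whereas the quotient group \<open>A_Mod\<close> is a bare monoid record.\<close>

lemma comm_group_extend:
  assumes "comm_group \<lparr>carrier = C, monoid.mult = f, one = e\<rparr>"
  shows "comm_group \<lparr>carrier = C, monoid.mult = f, one = e, \<dots> = u\<rparr>"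
  using assms
  unfolding comm_group_def comm_monoid_def comm_monoid_axioms_def
    group_def group_axioms_def monoid_def Units_def monoid.simps partial_object.simps .

lemma module_quotient_module:
  assumes V: "module K V" and W: "submodule W K V"
  shows "module K (quotient_module V W)"
proof -
  interpret module K V by fact
  interpret W: abelian_subgroup W V by (rule submodule_imp_abelian_subgroup) fact+
  note smult = quotient_smult_coset[OF V W]
  note [simp del] = quotient_module_simps(4)
  have "comm_group (add_monoid (quotient_module V W))"
    using W.a_factorgroup_is_comm_group by (simp add: A_FactGroup_def' comm_group_extend)
  then have "abelian_group (quotient_module V W)"
    by (auto simp: abelian_group_def abelian_monoid_def abelian_group_axioms_def comm_group_def)
  moreover have rep: "\<exists>x\<in>carrier V. A = W +>\<^bsub>V\<^esub> x" if "A \<in> carrier (quotient_module V W)" for A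
    using that by (auto elim: a_rcosets_cases)
  note proj = linear_mapD[OF coset_linear_map[OF V W]]
  ultimately show ?thesis
  proof (intro moduleI[OF R.is_cring])
    fix a A assume "a \<in> carrier K" "A \<in> carrier (quotient_module V W)"
    then show "a \<odot>\<^bsub>quotient_module V W\<^esub> A \<in> carrier (quotient_module V W)"
      using rep smult proj(1) smult_closed by metis
  next
    fix a b A assume "a \<in> carrier K" "b \<in> carrier K" "A \<in> carrier (quotient_module V W)"
    then show "(a \<oplus>\<^bsub>K\<^esub> b) \<odot>\<^bsub>quotient_module V W\<^esub> A =
      a \<odot>\<^bsub>quotient_module V W\<^esub> A \<oplus>\<^bsub>quotient_module V W\<^esub> b \<odot>\<^bsub>quotient_module V W\<^esub> A"
      using rep smult proj(2) smult_closed smult_l_distr R.add.m_closed by metis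
  next
    fix a A B assume "a \<in> carrier K" "A \<in> carrier (quotient_module V W)"
      "B \<in> carrier (quotient_module V W)"
    then show "a \<odot>\<^bsub>quotient_module V W\<^esub> (A \<oplus>\<^bsub>quotient_module V W\<^esub> B) =
      a \<odot>\<^bsub>quotient_module V W\<^esub> A \<oplus>\<^bsub>quotient_module V W\<^esub> a \<odot>\<^bsub>quotient_module V W\<^esub> B"
      using rep smult proj(2) smult_closed smult_r_distr M.add.m_closed by metis
  next
    fix a b A assume "a \<in> carrier K" "b \<in> carrier K" "A \<in> carrier (quotient_module V W)"
    then show "(a \<otimes>\<^bsub>K\<^esub> b) \<odot>\<^bsub>quotient_module V W\<^esub> A =
      a \<odot>\<^bsub>quotient_module V W\<^esub> (b \<odot>\<^bsub>quotient_module V W\<^esub> A)"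
      using rep smult smult_closed smult_assoc1 R.m_closed by metis
  next
    fix A assume "A \<in> carrier (quotient_module V W)"
    then show "\<one>\<^bsub>K\<^esub> \<odot>\<^bsub>quotient_module V W\<^esub> A = A"
      using rep smult smult_one R.one_closed by metis
  qed
qed

lemma linear_map_quotient:
  assumes V: "module K V" "submodule I K V" and W: "module K W" "submodule J K W"
    and f: "linear_map K V W f"
    and g: "\<And>x. x \<in> carrier V \<Longrightarrow> g (I +>\<^bsub>V\<^esub> x) = J +>\<^bsub>W\<^esub> f x"
  shows "linear_map K (quotient_module V I) (quotient_module W J) g"
proof -
  note pV = linear_mapD[OF coset_linear_map[OF V]]
  note pW = linear_mapD[OF coset_linear_map[OF W]]
  note fD = linear_mapD[OF f]
  interpret V: module K V by fact
  have *: "\<exists>x\<in>carrier V. A = I +>\<^bsub>V\<^esub> x" if "A \<in> carrier (quotient_module V I)" for A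
    using that by (auto elim: a_rcosets_cases)
  show ?thesis
  proof (rule linear_mapI)
    fix A assume "A \<in> carrier (quotient_module V I)"
    with * show "g A \<in> carrier (quotient_module W J)"
      using g fD pW by metis
  next
    fix A B assume "A \<in> carrier (quotient_module V I)" "B \<in> carrier (quotient_module V I)"
    with * obtain x y where "x \<in> carrier V" "A = I +>\<^bsub>V\<^esub> x" "y \<in> carrier V" "B = I +>\<^bsub>V\<^esub> y"
      by blast
    then show "g (A \<oplus>\<^bsub>quotient_module V I\<^esub> B) = g A \<oplus>\<^bsub>quotient_module W J\<^esub> g B"
      using g fD pW(2) pV(2) V.add.m_closed by metis
  next
    fix a A assume "a \<in> carrier K" "A \<in> carrier (quotient_module V I)"
    with * obtain x where "a \<in> carrier K" "x \<in> carrier V" "A = I +>\<^bsub>V\<^esub> x"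
      by blast
    then show "g (a \<odot>\<^bsub>quotient_module V I\<^esub> A) = a \<odot>\<^bsub>quotient_module W J\<^esub> g A"
      using g fD pW(3) pV(3) V.smult_closed by metis
  qed
qed

lemma quotient_operad_simps [simp]:
  "component (quotient_operad P I) n = quotient_module (component P n) (I n)"
  "ounit (quotient_operad P I) = I 1 +>\<^bsub>component P 1\<^esub> ounit P"
  by (simp_all add: quotient_operad_def)

text \<open>The composition of cosets can be computed on representatives:
  \<open>(v \<oplus> x) \<circ>\<^sub>i (w \<oplus> y)\<close> is the sum of \<open>v \<circ>\<^sub>i (w \<oplus> y)\<close>, \<open>x \<circ>\<^sub>i w\<close> and \<open>x \<circ>\<^sub>i y\<close>, of
  which the first two lie in the ideal.\<close>

lemma quotient_pcomp_coset:
  assumes "operad_ideal K P I"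
    and n: "1 \<le> n" and m: "1 \<le> m" and i: "i \<in> {1..n}"
    and x: "x \<in> elems P n" and y: "y \<in> elems P m"
  shows "pcomp (quotient_operad P I) n m i (I n +>\<^bsub>component P n\<^esub> x) (I m +>\<^bsub>component P m\<^esub> y)
    = I (n + m - 1) +>\<^bsub>component P (n + m - 1)\<^esub> pcomp P n m i x y"
proof -
  interpret operad_ideal K P I by fact
  have nm: "1 \<le> n + m - 1"
    using n m by simp
  have sub: "abelian_subgroup (I r) (component P r)" if "1 \<le> r" for r
    using that by (intro submodule_imp_abelian_subgroup[where K = K] component_module ideal_submodule)
  interpret In: abelian_subgroup "I n" "component P n" by (rule sub[OF n])
  interpret Im: abelian_subgroup "I m" "component P m" by (rule sub[OF m])
  let ?V = "component P (n + m - 1)"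
  interpret I: abelian_subgroup "I (n + m - 1)" ?V by (rule sub[OF nm])
  let ?c = "\<lambda>x y. I (n + m - 1) +>\<^bsub>?V\<^esub> pcomp P n m i x y"
  have const: "?c x' y' = ?c x y"
    if x': "x' \<in> I n +>\<^bsub>component P n\<^esub> x" and y': "y' \<in> I m +>\<^bsub>component P m\<^esub> y" for x' y'
  proof -
    obtain v where v: "v \<in> I n" "x' = v \<oplus>\<^bsub>component P n\<^esub> x"
      using x' by (auto simp: a_r_coset_def')
    obtain w where w: "w \<in> I m" "y' = w \<oplus>\<^bsub>component P m\<^esub> y"
      using y' by (auto simp: a_r_coset_def')
    have el: "v \<in> elems P n" "w \<in> elems P m" "y' \<in> elems P m"
      using v w y by auto
    have "pcomp P n m i x' y' = pcomp P n m i v y' \<oplus>\<^bsub>?V\<^esub> pcomp P n m i x y'"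
      using linear_mapD(2)[OF pcomp_linear_left[OF n m i el(3)]] v el x by simp
    also have "pcomp P n m i x y' = pcomp P n m i x w \<oplus>\<^bsub>?V\<^esub> pcomp P n m i x y"
      using linear_mapD(2)[OF pcomp_linear_right[OF n m i x]] w el y by simp
    finally have "pcomp P n m i x' y' =
        (pcomp P n m i v y' \<oplus>\<^bsub>?V\<^esub> pcomp P n m i x w) \<oplus>\<^bsub>?V\<^esub> pcomp P n m i x y"
      using pcomp_closed[OF n m i el(1,3)] pcomp_closed[OF n m i x el(2)] pcomp_closed[OF n m i x y]
      by (simp add: I.a_assoc del: One_nat_def)
    moreover have "pcomp P n m i v y' \<oplus>\<^bsub>?V\<^esub> pcomp P n m i x w \<in> I (n + m - 1)"
      using ideal_left[OF m n i el(3) v(1)] ideal_right[OF n m i x w(1)] by blast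
    ultimately have "pcomp P n m i x' y' \<in> ?c x y"
      by (auto simp: a_r_coset_def')
    then show ?thesis
      using I.a_repr_independence' pcomp_closed[OF n m i x y] by auto
  qed
  have "(\<Union>x'\<in>I n +>\<^bsub>component P n\<^esub> x. \<Union>y'\<in>I m +>\<^bsub>component P m\<^esub> y. ?c x' y') = ?c x y"
    using In.a_rcos_self[OF x] Im.a_rcos_self[OF y] const by blast
  then show ?thesis
    by (simp add: quotient_operad_def)
qed

theorem ns_operad_quotient:
  assumes ideal: "operad_ideal K P I"
  shows "ns_operad K (quotient_operad P I)"
proof -
  interpret operad_ideal K P I by fact
  note pc = quotient_pcomp_coset[OF ideal]
  have rep: "\<exists>x\<in>elems P n. A = I n +>\<^bsub>component P n\<^esub> x" if "A \<in> elems (quotient_operad P I) n" for A n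
    using that by (auto elim: a_rcosets_cases)
  have coset: "I n +>\<^bsub>component P n\<^esub> x \<in> elems (quotient_operad P I) n"
    if "1 \<le> n" "x \<in> elems P n" for n x
    using linear_mapD(1)[OF coset_linear_map[OF component_module ideal_submodule]] that by simp
  show ?thesis
  proof (intro ns_operad.intro ns_operad_axioms.intro)
    show "field K"
      by (rule field_axioms)
  next
    fix n :: nat assume "1 \<le> n"
    then show "module K (component (quotient_operad P I) n)"
      by (simp add: module_quotient_module component_module ideal_submodule)
  next
    fix n m i :: nat and B
    assume *: "1 \<le> n" "1 \<le> m" "i \<in> {1..n}" "B \<in> elems (quotient_operad P I) m"
    then obtain y where y: "y \<in> elems P m" "B = I m +>\<^bsub>component P m\<^esub> y"
      using rep by blast
    show "linear_map K (component (quotient_operad P I) n)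
        (component (quotient_operad P I) (n + m - 1))
        (\<lambda>A. pcomp (quotient_operad P I) n m i A B)"
      unfolding quotient_operad_simps y(2)
      by (rule linear_map_quotient[OF _ _ _ _ pcomp_linear_left[OF *(1-3) y(1)]])
        (use * y(1) pc in \<open>auto intro!: component_module ideal_submodule\<close>)
  next
    fix n m i :: nat and A
    assume *: "1 \<le> n" "1 \<le> m" "i \<in> {1..n}" "A \<in> elems (quotient_operad P I) n"
    then obtain x where x: "x \<in> elems P n" "A = I n +>\<^bsub>component P n\<^esub> x"
      using rep by blast
    show "linear_map K (component (quotient_operad P I) m)
        (component (quotient_operad P I) (n + m - 1))
        (\<lambda>B. pcomp (quotient_operad P I) n m i A B)"
      unfolding quotient_operad_simps x(2)
      by (rule linear_map_quotient[OF _ _ _ _ pcomp_linear_right[OF *(1-3) x(1)]])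
        (use * x(1) pc in \<open>auto intro!: component_module ideal_submodule\<close>)
  next
    show "ounit (quotient_operad P I) \<in> elems (quotient_operad P I) 1"
      using coset[OF _ unit_closed] by simp
  next
    fix m :: nat and B assume *: "1 \<le> m" "B \<in> elems (quotient_operad P I) m"
    then obtain y where y: "y \<in> elems P m" "B = I m +>\<^bsub>component P m\<^esub> y"
      using rep by blast
    then show "pcomp (quotient_operad P I) 1 m 1 (ounit (quotient_operad P I)) B = B"
      using * pc[of 1 m 1 "ounit P" y] unit_closed unit_left by simp
  next
    fix n i :: nat and A assume *: "1 \<le> n" "i \<in> {1..n}" "A \<in> elems (quotient_operad P I) n"
    then obtain x where x: "x \<in> elems P n" "A = I n +>\<^bsub>component P n\<^esub> x"
      using rep by blast
    then show "pcomp (quotient_operad P I) n 1 i A (ounit (quotient_operad P I)) = A"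
      using * pc[of n 1 i x "ounit P"] unit_closed unit_right by simp
  next
    fix n m l i j :: nat and A B C
    assume *: "1 \<le> n" "1 \<le> m" "1 \<le> l" "i \<in> {1..n}" "j \<in> {1..m}"
      "A \<in> elems (quotient_operad P I) n" "B \<in> elems (quotient_operad P I) m"
      "C \<in> elems (quotient_operad P I) l"
    then obtain x y z where xyz: "x \<in> elems P n" "A = I n +>\<^bsub>component P n\<^esub> x"
      "y \<in> elems P m" "B = I m +>\<^bsub>component P m\<^esub> y" "z \<in> elems P l" "C = I l +>\<^bsub>component P l\<^esub> z"
      using rep by meson
    have **: "1 \<le> n + m - 1" "i + j - 1 \<in> {1..n + m - 1}" "1 \<le> m + l - 1"
      "n + m - 1 + l - 1 = n + (m + l - 1) - 1"
      using * by auto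
    then show "pcomp (quotient_operad P I) (n + m - 1) l (i + j - 1)
        (pcomp (quotient_operad P I) n m i A B) C =
      pcomp (quotient_operad P I) n (m + l - 1) i A (pcomp (quotient_operad P I) m l j B C)"
      using * ** xyz assoc_sequential[of n m l i j x y z] by (simp only: pc pcomp_closed)
  next
    fix n m l i j :: nat and A B C
    assume *: "1 \<le> n" "1 \<le> m" "1 \<le> l" "i \<in> {1..n}" "j \<in> {1..n}" "i < j"
      "A \<in> elems (quotient_operad P I) n" "B \<in> elems (quotient_operad P I) m"
      "C \<in> elems (quotient_operad P I) l"
    then obtain x y z where xyz: "x \<in> elems P n" "A = I n +>\<^bsub>component P n\<^esub> x"
      "y \<in> elems P m" "B = I m +>\<^bsub>component P m\<^esub> y" "z \<in> elems P l" "C = I l +>\<^bsub>component P l\<^esub> z"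
      using rep by meson
    have **: "1 \<le> n + m - 1" "j + m - 1 \<in> {1..n + m - 1}" "1 \<le> n + l - 1" "i \<in> {1..n + l - 1}"
      "n + m - 1 + l - 1 = n + l - 1 + m - 1"
      using * by auto
    then show "pcomp (quotient_operad P I) (n + m - 1) l (j + m - 1)
        (pcomp (quotient_operad P I) n m i A B) C =
      pcomp (quotient_operad P I) (n + l - 1) m i (pcomp (quotient_operad P I) n l j A C) B"
      using * ** xyz assoc_parallel[of n m l i j x y z] by (simp only: pc pcomp_closed)
  qed
qed

lemma operad_iso_inverse:
  assumes P: "ns_operad K P" and iso: "operad_iso K P Q \<phi>"
  shows "operad_iso K Q P (\<lambda>n. the_inv_into (elems P n) (\<phi> n))"
proof -
  interpret ns_operad K P by fact
  define \<psi> where "\<psi> = (\<lambda>n. the_inv_into (elems P n) (\<phi> n))"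
  have lin: "linear_map K (component P n) (component Q n) (\<phi> n)"
    and bij: "bij_betw (\<phi> n) (elems P n) (elems Q n)" if "1 \<le> n" for n
    using iso that by (auto simp: operad_iso_def)
  have inv: "\<psi> n (\<phi> n x) = x" if "1 \<le> n" "x \<in> elems P n" for n x
    using bij that by (auto simp: \<psi>_def bij_betw_def the_inv_into_f_f)
  have rep: "\<exists>x\<in>elems P n. y = \<phi> n x" if "1 \<le> n" "y \<in> elems Q n" for n y
    using bij[OF that(1)] that(2) by (auto simp: bij_betw_def)
  have "operad_iso K Q P \<psi>"
    unfolding operad_iso_def
  proof (intro conjI allI impI ballI)
    fix n :: nat assume n: "1 \<le> n"
    interpret module K "component P n" by (rule component_module[OF n])
    show "linear_map K (component Q n) (component P n) (\<psi> n)"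
    proof (rule linear_mapI)
      fix x assume "x \<in> elems Q n" then show "\<psi> n x \<in> elems P n"
        using rep[OF n] inv[OF n] by metis
    next
      fix x y assume "x \<in> elems Q n" "y \<in> elems Q n"
      then show "\<psi> n (x \<oplus>\<^bsub>component Q n\<^esub> y) = \<psi> n x \<oplus>\<^bsub>component P n\<^esub> \<psi> n y"
        using rep[OF n] inv[OF n] linear_mapD(2)[OF lin[OF n]] M.add.m_closed by metis
    next
      fix a x assume "a \<in> carrier K" "x \<in> elems Q n"
      then show "\<psi> n (a \<odot>\<^bsub>component Q n\<^esub> x) = a \<odot>\<^bsub>component P n\<^esub> \<psi> n x"
        using rep[OF n] inv[OF n] linear_mapD(3)[OF lin[OF n]] smult_closed by metis
    qed
    show "bij_betw (\<psi> n) (elems Q n) (elems P n)"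
      unfolding \<psi>_def by (rule bij_betw_the_inv_into[OF bij[OF n]])
  next
    show "\<psi> 1 (ounit Q) = ounit P"
      using iso inv[OF _ unit_closed] by (auto simp: operad_iso_def)
  next
    fix n m i :: nat and x y
    assume *: "1 \<le> n" "1 \<le> m" "i \<in> {1..n}" "x \<in> elems Q n" "y \<in> elems Q m"
    then obtain a b where ab: "a \<in> elems P n" "x = \<phi> n a" "b \<in> elems P m" "y = \<phi> m b"
      using rep by meson
    have "pcomp Q n m i x y = \<phi> (n + m - 1) (pcomp P n m i a b)"
      using iso * ab by (simp add: operad_iso_def)
    moreover have "1 \<le> n + m - 1"
      using * by auto
    ultimately show "\<psi> (n + m - 1) (pcomp Q n m i x y) = pcomp P n m i (\<psi> n x) (\<psi> m y)"
      using * ab by (simp only: inv pcomp_closed)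
  qed
  then show ?thesis
    by (simp add: \<psi>_def)
qed

text \<open>If an operad is, in each arity, the direct sum of an ideal \<open>I\<close> and a suboperad \<open>S\<close>, then the
  projection restricts to an isomorphism from \<open>S\<close> to the quotient by \<open>I\<close>.\<close>

theorem quotient_isomorphic_complement:
  assumes ideal: "operad_ideal K P I" and subop: "suboperad K P S"
    and inter: "\<And>n. 1 \<le> n \<Longrightarrow> I n \<inter> S n \<subseteq> {\<zero>\<^bsub>component P n\<^esub>}"
    and sum: "\<And>n x. \<lbrakk>1 \<le> n; x \<in> elems P n\<rbrakk> \<Longrightarrow> \<exists>v\<in>I n. \<exists>s\<in>S n. x = v \<oplus>\<^bsub>component P n\<^esub> s"
  shows "operads_isomorphic K (quotient_operad P I) (restrict_operad P S)"
proof -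
  interpret I: operad_ideal K P I by fact
  interpret S: suboperad K P S by fact
  have R: "ns_operad K (restrict_operad P S)"
    by (rule ns_operad_restrict[OF subop])
  let ?\<phi> = "\<lambda>n x. I n +>\<^bsub>component P n\<^esub> x"
  have sub: "S n \<subseteq> elems P n" if "1 \<le> n" for n
    using module.submoduleE(1)[OF I.component_module S.sub_submodule] that by blast
  have "operad_iso K (restrict_operad P S) (quotient_operad P I) ?\<phi>"
    unfolding operad_iso_def
  proof (intro conjI allI impI ballI)
    fix n :: nat assume n: "1 \<le> n"
    note nn = I.component_module[OF n] I.ideal_submodule[OF n]
    interpret V: module K "component P n" by (rule nn)
    interpret W: abelian_subgroup "I n" "component P n"
      by (rule submodule_imp_abelian_subgroup[OF nn])
    show "linear_map K (component (restrict_operad P S) n) (component (quotient_operad P I) n) (?\<phi> n)"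
      using coset_linear_map[OF nn] sub[OF n]
      by (auto simp: linear_map_def subset_iff simp del: quotient_module_simps)
    have "inj_on (?\<phi> n) (S n)"
    proof (rule inj_onI)
      fix s t assume st: "s \<in> S n" "t \<in> S n" "?\<phi> n s = ?\<phi> n t"
      then have el: "s \<in> elems P n" "t \<in> elems P n"
        using sub[OF n] by auto
      then have "s \<ominus>\<^bsub>component P n\<^esub> t \<in> I n"
        using W.a_rcos_module[of t s] W.a_rcos_self[of s] st(3) by (simp add: a_minus_def)
      moreover have "s \<ominus>\<^bsub>component P n\<^esub> t \<in> S n"
        using V.submoduleE(3,5)[OF S.sub_submodule[OF n]] st by (simp add: a_minus_def)
      ultimately have "s \<ominus>\<^bsub>component P n\<^esub> t = \<zero>\<^bsub>component P n\<^esub>"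
        using inter[OF n] by blast
      then show "s = t"
        using el V.minus_equality V.minus_minus V.a_inv_closed by (metis a_minus_def)
    qed
    moreover have "?\<phi> n ` S n = a_rcosets\<^bsub>component P n\<^esub> (I n)"
    proof
      show "?\<phi> n ` S n \<subseteq> a_rcosets\<^bsub>component P n\<^esub> (I n)"
        using sub[OF n] V.a_rcosetsI[OF W.a_subset] by auto
      show "a_rcosets\<^bsub>component P n\<^esub> (I n) \<subseteq> ?\<phi> n ` S n"
      proof
        fix A assume "A \<in> a_rcosets\<^bsub>component P n\<^esub> (I n)"
        then obtain x where x: "x \<in> elems P n" "A = ?\<phi> n x"
          by (rule a_rcosets_cases)
        then obtain v s where vs: "v \<in> I n" "s \<in> S n" "x = v \<oplus>\<^bsub>component P n\<^esub> s"
          using sum[OF n] by blast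
        then have "x \<in> ?\<phi> n s"
          by (auto simp: a_r_coset_def')
        then have "?\<phi> n s = A"
          using W.a_repr_independence' vs sub[OF n] x by auto
        then show "A \<in> ?\<phi> n ` S n"
          using vs by blast
      qed
    qed
    ultimately show "bij_betw (?\<phi> n) (elems (restrict_operad P S) n) (elems (quotient_operad P I) n)"
      by (simp add: bij_betw_def)
  next
    show "?\<phi> 1 (ounit (restrict_operad P S)) = ounit (quotient_operad P I)"
      by simp
  next
    fix n m i :: nat and x y
    assume "1 \<le> n" "1 \<le> m" "i \<in> {1..n}" "x \<in> elems (restrict_operad P S) n"
      "y \<in> elems (restrict_operad P S) m"
    then show "?\<phi> (n + m - 1) (pcomp (restrict_operad P S) n m i x y) =
      pcomp (quotient_operad P I) n m i (?\<phi> n x) (?\<phi> m y)"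
      using quotient_pcomp_coset[OF ideal] sub by (simp add: subset_iff)
  qed
  from operad_iso_inverse[OF R this] show ?thesis
    unfolding operads_isomorphic_def using R ns_operad_quotient[OF ideal] by blast
qed

section \<open>Composition of cliques\<close>

text \<open>
  In the composite \<open>p \<circ>\<^sub>i q\<close>, with \<open>q\<close> of arity \<open>m\<close>, the vertex \<open>x\<close> of the polygon of \<open>p\<close> becomes
  the vertex \<open>outer m i x\<close>, and the vertex \<open>x\<close> of the polygon of \<open>q\<close> becomes \<open>inner i x\<close>.
  The subtractions do not truncate, as \<open>m\<close> and \<open>i\<close> are at least 1 in all uses. Since \<open>m\<close> is at
  least 1, \<open>outer\<close> is strictly increasing, and its values avoid the open interval from \<open>i\<close> to
  \<open>i + m\<close>.
\<close>

definition outer :: "nat \<Rightarrow> nat \<Rightarrow> nat \<Rightarrow> nat"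
  where "outer m i x = (if x \<le> i then x else x + m - 1)"

definition inner :: "nat \<Rightarrow> nat \<Rightarrow> nat"
  where "inner i x = x + i - 1"

lemma outer_less_iff: "1 \<le> m \<Longrightarrow> outer m i x < outer m i y \<longleftrightarrow> x < y"
  by (auto simp: outer_def)

lemma inner_less_iff: "1 \<le> i \<Longrightarrow> inner i x < inner i y \<longleftrightarrow> x < y"
  by (auto simp: inner_def)

lemma crossing_outer_iff:
  "1 \<le> m \<Longrightarrow> crossing (outer m i x, outer m i y) (outer m i x', outer m i y') \<longleftrightarrow>
    crossing (x, y) (x', y')"
  by (simp only: crossing.simps outer_less_iff)

lemma crossing_inner_iff:
  "1 \<le> i \<Longrightarrow> crossing (inner i x, inner i y) (inner i x', inner i y') \<longleftrightarrow>
    crossing (x, y) (x', y')"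
  by (simp only: crossing.simps inner_less_iff)

text \<open>The next three identities express the two ways of inserting vertices in the nested composite
  \<open>(p \<circ>\<^sub>i q) \<circ>\<^sub>i\<^sub>+\<^sub>j\<^sub>-\<^sub>1 r = p \<circ>\<^sub>i (q \<circ>\<^sub>j r)\<close>; the three after them do the same for the composites
  at two distinct inputs \<open>i < j\<close> of \<open>p\<close>.\<close>

lemma outer_outer_nested:
  "\<lbrakk>1 \<le> l; j \<in> {1..m}\<rbrakk> \<Longrightarrow> outer l (i + j - 1) (outer m i x) = outer (m + l - 1) i x"
  by (auto simp: outer_def)

lemma outer_inner_nested:
  "\<lbrakk>1 \<le> i; 1 \<le> x\<rbrakk> \<Longrightarrow> outer l (i + j - 1) (inner i x) = inner i (outer l j x)"
  by (auto simp: outer_def inner_def)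

lemma inner_inner_nested: "\<lbrakk>1 \<le> i; 1 \<le> j\<rbrakk> \<Longrightarrow> inner (i + j - 1) x = inner i (inner j x)"
  by (auto simp: inner_def)

lemma outer_outer_disjoint:
  "\<lbrakk>1 \<le> m; 1 \<le> l; i < j\<rbrakk> \<Longrightarrow> outer l (j + m - 1) (outer m i x) = outer m i (outer l j x)"
  by (auto simp: outer_def)

lemma outer_inner_disjoint:
  "\<lbrakk>x \<le> m + 1; i < j\<rbrakk> \<Longrightarrow> outer l (j + m - 1) (inner i x) = inner i x"
  by (auto simp: outer_def inner_def)

lemma inner_outer_disjoint:
  "\<lbrakk>1 \<le> m; 1 \<le> x; i < j\<rbrakk> \<Longrightarrow> inner (j + m - 1) x = outer m i (inner j x)"
  by (auto simp: outer_def inner_def)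

lemma clique_extensional: "\<lbrakk>p \<in> cliques M n; a \<notin> arcs n\<rbrakk> \<Longrightarrow> p a = undefined"
  unfolding cliques_def by (blast intro: PiE_arb)

lemma clique_label_closed: "\<lbrakk>p \<in> cliques M n; a \<in> arcs n\<rbrakk> \<Longrightarrow> p a \<in> carrier M"
  by (auto simp: cliques_def)

lemma clique_one: "p \<in> cliques M (Suc 0) \<Longrightarrow> p (Suc 0, Suc (Suc 0)) = \<one>\<^bsub>M\<^esub>"
  by (auto simp: cliques_def numeral_2_eq_2)

lemma clique_eqI:
  assumes "p \<in> cliques M n" "q \<in> cliques M n"
    and "\<And>x y. \<lbrakk>1 \<le> x; x < y; y \<le> n + 1\<rbrakk> \<Longrightarrow> p (x, y) = q (x, y)"
  shows "p = q"
proof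
  fix a show "p a = q a"
    using assms clique_extensional[OF assms(1), of a] clique_extensional[OF assms(2), of a]
    by (cases a; cases "a \<in> arcs n") (auto simp: arcs_def)
qed

lemma clique_comp_apply:
  assumes "1 \<le> x" "x < y" "y \<le> n + m - 1 + 1"
  shows "clique_comp M n m i p q (x, y) =
   (if y \<le> i then p (x, y)
    else if x \<le> i \<and> i + m \<le> y \<and> (x, y) \<noteq> (i, i + m) then p (x, y - m + 1)
    else if i + m \<le> x then p (x - m + 1, y - m + 1)
    else if i \<le> x \<and> y \<le> i + m \<and> (x, y) \<noteq> (i, i + m) then q (x - i + 1, y - i + 1)
    else if (x, y) = (i, i + m) then p (i, i + 1) \<otimes>\<^bsub>M\<^esub> q (1, m + 1)
    else \<one>\<^bsub>M\<^esub>)"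
  using assms unfolding clique_comp_def by (simp add: arcs_def)

text \<open>The labels of a composite, one lemma for each kind of arc. The \<open>i\<close>-th edge of \<open>p\<close> and the base
  of \<open>q\<close> are excluded from the first two, since they are merged into the single arc \<open>(i, i + m)\<close>.\<close>

lemma clique_comp_outer:
  assumes "1 \<le> m" "1 \<le> x" "x < y" "y \<le> n + 1" "(x, y) \<noteq> (i, i + 1)"
  shows "clique_comp M n m i p q (outer m i x, outer m i y) = p (x, y)"
  using assms by (subst clique_comp_apply) (auto simp: outer_def)

lemma clique_comp_inner:
  assumes "i \<in> {1..n}" "1 \<le> x" "x < y" "y \<le> m + 1" "(x, y) \<noteq> (1, m + 1)"
  shows "clique_comp M n m i p q (inner i x, inner i y) = q (x, y)"
proof -
  obtain i' x' y' where "i = Suc i'" "x = Suc x'" "y = Suc y'"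
    using assms by (cases i; cases x; cases y) auto
  then show ?thesis
    using assms by (subst clique_comp_apply) (auto simp: inner_def)
qed

lemma clique_comp_base:
  assumes "1 \<le> m" "i \<in> {1..n}"
  shows "clique_comp M n m i p q (i, i + m) = p (i, i + 1) \<otimes>\<^bsub>M\<^esub> q (1, m + 1)"
  using assms by (subst clique_comp_apply) auto

lemma clique_comp_crossing:
  assumes "1 \<le> x" "x < y" "y \<le> n + m - 1 + 1" "crossing (i, i + m) (x, y)"
  shows "clique_comp M n m i p q (x, y) = \<one>\<^bsub>M\<^esub>"
proof -
  consider "x < i" "i < y" "y < i + m" | "i < x" "x < i + m" "i + m < y"
    using assms(4) by auto
  then show ?thesis
    by cases (simp_all add: clique_comp_apply[OF assms(1-3)])
qed

text \<open>An arc with one end strictly between \<open>i\<close> and \<open>i + m\<close> and the other end outside the closed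
  interval crosses \<open>(i, i + m)\<close>. Any other arc has both ends in the closed interval, or none in
  the open one; unless it is \<open>(i, i + m)\<close> itself, it then comes from \<open>q\<close> or \<open>p\<close>, respectively.\<close>

lemma composite_arc_cases:
  assumes "1 \<le> m" "i \<in> {1..n}" "1 \<le> x" "x < y" "y \<le> n + m - 1 + 1"
  obtains
    (outer) a b where "1 \<le> a" "a < b" "b \<le> n + 1" "(a, b) \<noteq> (i, i + 1)"
      "x = outer m i a" "y = outer m i b"
  | (inner) a b where "1 \<le> a" "a < b" "b \<le> m + 1" "(a, b) \<noteq> (1, m + 1)"
      "x = inner i a" "y = inner i b"
  | (base) "x = i" "y = i + m"
  | (crossing) "crossing (i, i + m) (x, y)"
proof -
  \<comment> \<open>a left inverse of \<open>outer m i\<close> away from the open interval from \<open>i\<close> to \<open>i + m\<close>\<close>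
  let ?a = "\<lambda>x. if x \<le> i then x else x + 1 - m"
  consider "(x, y) = (i, i + m)"
    | "crossing (i, i + m) (x, y)"
    | "i \<le> x" "y \<le> i + m" "(x, y) \<noteq> (i, i + m)"
    | "x \<le> i \<or> i + m \<le> x" "y \<le> i \<or> i + m \<le> y" "(x, y) \<noteq> (i, i + m)"
    using assms by fastforce
  then show thesis
  proof cases
    case 3
    then show ?thesis
      using assms by (intro inner[of "x + 1 - i" "y + 1 - i"]) (auto simp: inner_def)
  next
    case 4
    then show ?thesis
    proof (intro outer[of "?a x" "?a y"])
      show "x = outer m i (?a x)" "y = outer m i (?a y)"
        using 4 assms(1,2) by (auto simp: outer_def)
      show "1 \<le> ?a x" "?a x < ?a y" "?a y \<le> n + 1" "(?a x, ?a y) \<noteq> (i, i + 1)"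
        using 4 assms by (auto split: if_splits)
    qed
  qed (use base crossing in auto)
qed

context unitary_magma
begin

lemma unit_clique_in_cliques: "unit_clique M \<in> cliques M 1"
  using one_closed by (auto simp: unit_clique_def cliques_def arcs_def)

lemma clique_comp_in_cliques:
  assumes "1 \<le> n" "1 \<le> m" "i \<in> {1..n}" "p \<in> cliques M n" "q \<in> cliques M m"
  shows "clique_comp M n m i p q \<in> cliques M (n + m - 1)"
proof -
  have "clique_comp M n m i p q (x, y) \<in> carrier M" if "(x, y) \<in> arcs (n + m - 1)" for x y
  proof -
    have *: "1 \<le> x" "x < y" "y \<le> n + m - 1 + 1"
      using that by (auto simp: arcs_def)
    show ?thesis
      using assms(2,3) *
    proof (cases rule: composite_arc_cases)
      case (outer a b)
      then show ?thesis
        using clique_label_closed[OF assms(4), of "(a, b)"]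
        by (simp add: arcs_def clique_comp_outer[OF assms(2) outer(1-4)])
    next
      case (inner a b)
      then show ?thesis
        using clique_label_closed[OF assms(5), of "(a, b)"]
        by (simp add: arcs_def clique_comp_inner[OF assms(3) inner(1-4)])
    next
      case base
      then show ?thesis
        using assms(1-3)
          m_closed[OF clique_label_closed[OF assms(4), of "(i, i + 1)"] clique_label_closed[OF assms(5), of "(1, m + 1)"]]
        by (simp add: arcs_def clique_comp_base)
    next
      case crossing
      then show ?thesis
        using one_closed by (simp add: clique_comp_crossing[OF *])
    qed
  qed
  moreover have "clique_comp M n m i p q (1, 2) = \<one>" if "n + m - 1 = 1"
  proof -
    have "n = 1" "m = 1" "i = 1"
      using that assms by auto
    then show ?thesis
      using assms one_closed by (auto simp: clique_comp_apply clique_one l_one numeral_2_eq_2)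
  qed
  ultimately show ?thesis
    by (auto simp: cliques_def clique_comp_def intro: PiE_I split del: if_split)
qed

lemma clique_comp_unit_left:
  assumes "1 \<le> m" "q \<in> cliques M m"
  shows "clique_comp M 1 m 1 (unit_clique M) q = q"
proof (rule clique_eqI)
  show "clique_comp M 1 m 1 (unit_clique M) q \<in> cliques M m"
    using clique_comp_in_cliques[of 1 m 1 "unit_clique M" q] assms unit_clique_in_cliques by simp
next
  fix x y assume *: "1 \<le> x" "x < y" "y \<le> m + 1"
  then show "clique_comp M 1 m 1 (unit_clique M) q (x, y) = q (x, y)"
    using clique_label_closed[OF assms(2), of "(x, y)"]
    by (auto simp: clique_comp_apply l_one unit_clique_def arcs_def)
qed fact

lemma clique_comp_unit_right:
  assumes "1 \<le> n" "i \<in> {1..n}" "p \<in> cliques M n"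
  shows "clique_comp M n 1 i p (unit_clique M) = p"
proof (rule clique_eqI)
  show "clique_comp M n 1 i p (unit_clique M) \<in> cliques M n"
    using clique_comp_in_cliques[of n 1 i p "unit_clique M"] assms unit_clique_in_cliques by simp
next
  fix x y assume *: "1 \<le> x" "x < y" "y \<le> n + 1"
  then show "clique_comp M n 1 i p (unit_clique M) (x, y) = p (x, y)"
    using clique_label_closed[OF assms(3), of "(x, y)"] assms
    by (auto simp: clique_comp_apply r_one unit_clique_def arcs_def)
qed fact

text \<open>The only arc whose label can involve more than one product is \<open>(i, i + l)\<close> when \<open>q\<close> has arity
  1, where the labels \<open>p\<^sub>i\<close>, \<open>q\<^sub>0\<close> and \<open>r\<^sub>0\<close> meet. It is harmless because the clique of arity 1 is
  labelled by the unit.\<close>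

lemma clique_comp_sequential:
  assumes "1 \<le> n" "1 \<le> m" "1 \<le> l" "i \<in> {1..n}" "j \<in> {1..m}"
    "p \<in> cliques M n" "q \<in> cliques M m" "r \<in> cliques M l"
  shows "clique_comp M (n + m - 1) l (i + j - 1) (clique_comp M n m i p q) r =
    clique_comp M n (m + l - 1) i p (clique_comp M m l j q r)"
proof (rule clique_eqI)
  have eq: "n + (m + l - 1) - 1 = n + m - 1 + l - 1"
    using assms by simp
  show "clique_comp M (n + m - 1) l (i + j - 1) (clique_comp M n m i p q) r
      \<in> cliques M (n + m - 1 + l - 1)"
    using assms by (intro clique_comp_in_cliques) auto
  show "clique_comp M n (m + l - 1) i p (clique_comp M m l j q r) \<in> cliques M (n + m - 1 + l - 1)"
    unfolding eq[symmetric] using assms by (intro clique_comp_in_cliques) auto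
  fix x y assume *: "1 \<le> x" "x < y" "y \<le> n + m - 1 + l - 1 + 1"
  let ?L = "clique_comp M (n + m - 1) l (i + j - 1) (clique_comp M n m i p q) r"
  let ?R = "clique_comp M n (m + l - 1) i p (clique_comp M m l j q r)"
  have ml: "1 \<le> m + l - 1" "y \<le> n + (m + l - 1) - 1 + 1"
    using assms * by auto
  have ij: "i + j - 1 \<in> {1..n + m - 1}"
    using assms by auto
  show "?L (x, y) = ?R (x, y)"
    using ml(1) assms(4) *(1,2) ml(2)
  proof (cases rule: composite_arc_cases)
    case (outer a b)
    let ?a = "outer m i a" and ?b = "outer m i b"
    have eq: "x = outer l (i + j - 1) ?a" "y = outer l (i + j - 1) ?b"
      by (simp_all only: outer(5,6) outer_outer_nested[OF assms(3,5)])
    have "?R (x, y) = p (a, b)"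
      unfolding outer(5,6) using outer ml by (intro clique_comp_outer) auto
    moreover have "?L (x, y) = clique_comp M n m i p q (?a, ?b)"
      unfolding eq using outer assms by (intro clique_comp_outer) (auto simp: outer_def)
    moreover have "clique_comp M n m i p q (?a, ?b) = p (a, b)"
      using outer assms by (intro clique_comp_outer) auto
    ultimately show ?thesis
      by simp
  next
    case (inner a' b')
    then have b': "b' \<le> m + l - 1 + 1"
      by simp
    have R: "?R (x, y) = clique_comp M m l j q r (a', b')"
      unfolding inner(5,6) using inner assms by (intro clique_comp_inner) auto
    show ?thesis
      using assms(3) assms(5) inner(1,2) b'
    proof (cases rule: composite_arc_cases)
      case (outer a b)
      let ?a = "inner i a" and ?b = "inner i b"
      have eq: "x = outer l (i + j - 1) ?a" "y = outer l (i + j - 1) ?b"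
        using outer(1,2) assms(4) outer_inner_nested[of i _ l j] by (auto simp: inner(5,6) outer(5,6))
      have "clique_comp M m l j q r (a', b') = q (a, b)"
        unfolding outer(5,6) using outer assms by (intro clique_comp_outer) auto
      moreover have "?L (x, y) = clique_comp M n m i p q (?a, ?b)"
        unfolding eq using outer assms by (intro clique_comp_outer) (auto simp: inner_def)
      moreover have "clique_comp M n m i p q (?a, ?b) = q (a, b)"
        using outer inner assms by (intro clique_comp_inner) (auto simp: outer_def)
      ultimately show ?thesis
        using R by simp
    next
      case inner': (inner a b)
      have eq: "x = inner (i + j - 1) a" "y = inner (i + j - 1) b"
        using assms(4,5) inner(5,6) inner'(5,6) inner_inner_nested by auto
      have "clique_comp M m l j q r (a', b') = r (a, b)"
        unfolding inner'(5,6) using inner' assms by (intro clique_comp_inner) auto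
      moreover have "?L (x, y) = r (a, b)"
        unfolding eq using inner' ij by (intro clique_comp_inner) auto
      ultimately show ?thesis
        using R by simp
    next
      case base
      have eq: "x = i + j - 1" "y = i + j - 1 + l"
        using inner base assms by (auto simp: inner_def)
      have "?L (x, y) = clique_comp M n m i p q (inner i j, inner i (j + 1)) \<otimes> r (1, l + 1)"
        unfolding eq using clique_comp_base[OF assms(3) ij] assms(4,5) by (simp add: inner_def add.commute)
      also have "clique_comp M n m i p q (inner i j, inner i (j + 1)) = q (j, j + 1)"
        using base inner assms by (intro clique_comp_inner) auto
      finally show ?thesis
        using R by (simp add: base clique_comp_base[OF assms(3,5), simplified])
    next
      case crossing
      have "clique_comp M m l j q r (a', b') = \<one>"
        using inner crossing by (intro clique_comp_crossing) auto
      moreover have "?L (x, y) = \<one>"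
      proof (intro clique_comp_crossing *)
        have "i + j - 1 = inner i j" "i + j - 1 + l = inner i (j + l)"
          using assms(4,5) by (auto simp: inner_def)
        then show "crossing (i + j - 1, i + j - 1 + l) (x, y)"
          using crossing assms(4) by (simp only: inner(5,6) crossing_inner_iff atLeastAtMost_iff)
      qed
      ultimately show ?thesis
        using R by simp
    qed
  next
    case base
    have R: "?R (x, y) = p (i, i + 1) \<otimes> clique_comp M m l j q r (1, m + l - 1 + 1)"
      unfolding base using clique_comp_base[OF ml(1) assms(4)] by simp
    show ?thesis
    proof (cases "m = 1")
      case True
      then have "j = 1" "q (1, 2) = \<one>"
        using assms clique_one[of q M] by (auto simp: numeral_2_eq_2)
      moreover have "p (i, i + 1) \<in> carrier M" "r (1, l + 1) \<in> carrier M"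
        using assms by (auto intro!: clique_label_closed simp: arcs_def)
      moreover have "clique_comp M m l 1 q r (1, m + l - 1 + 1) = q (1, 2) \<otimes> r (1, l + 1)"
        using clique_comp_base[of l 1 m M q r] assms True by (simp add: numeral_2_eq_2)
      moreover have "clique_comp M n m i p q (i, i + 1) = p (i, i + 1) \<otimes> q (1, 2)"
        using clique_comp_base[of m i n M p q] assms True by (simp add: numeral_2_eq_2)
      moreover have "?L (x, y) = clique_comp M n m i p q (i, i + 1) \<otimes> r (1, l + 1)"
        using base True clique_comp_base[OF assms(3) ij] \<open>j = 1\<close> by simp
      ultimately show ?thesis
        using R by (simp add: l_one r_one)
    next
      case False
      have eq: "x = outer l (i + j - 1) i" "y = outer l (i + j - 1) (i + m)"
        using base assms by (auto simp: outer_def)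
      have "?L (x, y) = clique_comp M n m i p q (i, i + m)"
        unfolding eq using assms False by (intro clique_comp_outer) auto
      moreover have "clique_comp M m l j q r (outer l j 1, outer l j (m + 1)) = q (1, m + 1)"
        using assms False by (intro clique_comp_outer) auto
      moreover have "outer l j 1 = 1" "outer l j (m + 1) = m + l - 1 + 1"
        using assms by (auto simp: outer_def)
      ultimately show ?thesis
        using R by (simp add: clique_comp_base[OF assms(2,4), simplified])
    qed
  next
    case crossing
    have "?R (x, y) = \<one>"
      using *(1,2) ml(2) crossing by (rule clique_comp_crossing)
    moreover have "?L (x, y) = \<one>"
      using assms(3) ij *
    proof (cases rule: composite_arc_cases)
      case (outer a b)
      have "?L (x, y) = clique_comp M n m i p q (a, b)"
        unfolding outer(5,6) using outer assms by (intro clique_comp_outer) auto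
      also have "\<dots> = \<one>"
      proof (intro clique_comp_crossing outer(1-3))
        have "outer l (i + j - 1) i = i" "outer l (i + j - 1) (i + m) = i + (m + l - 1)"
          using assms(3,5) by (auto simp: outer_def)
        then show "crossing (i, i + m) (a, b)"
          using crossing crossing_outer_iff[OF assms(3), of "i + j - 1" i "i + m" a b]
          by (simp only: outer(5,6))
      qed
      finally show ?thesis .
    next
      case (inner a b)
      then show ?thesis
        using crossing assms by (auto simp: inner_def)
    next
      case base
      then show ?thesis
        using crossing assms by auto
    next
      case crossing
      with * show ?thesis
        by (rule clique_comp_crossing)
    qed
    ultimately show ?thesis
      by simp
  qed
qed

lemma clique_comp_parallel:
  assumes "1 \<le> n" "1 \<le> m" "1 \<le> l" "i \<in> {1..n}" "j \<in> {1..n}" "i < j"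
    "p \<in> cliques M n" "q \<in> cliques M m" "r \<in> cliques M l"
  shows "clique_comp M (n + m - 1) l (j + m - 1) (clique_comp M n m i p q) r =
    clique_comp M (n + l - 1) m i (clique_comp M n l j p r) q"
proof (rule clique_eqI)
  have eq: "n + l - 1 + m - 1 = n + m - 1 + l - 1"
    using assms by simp
  show "clique_comp M (n + m - 1) l (j + m - 1) (clique_comp M n m i p q) r
      \<in> cliques M (n + m - 1 + l - 1)"
    using assms by (intro clique_comp_in_cliques) auto
  show "clique_comp M (n + l - 1) m i (clique_comp M n l j p r) q \<in> cliques M (n + m - 1 + l - 1)"
    unfolding eq[symmetric] using assms by (intro clique_comp_in_cliques) auto
  fix x y assume *: "1 \<le> x" "x < y" "y \<le> n + m - 1 + l - 1 + 1"
  let ?L = "clique_comp M (n + m - 1) l (j + m - 1) (clique_comp M n m i p q) r"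
  let ?R = "clique_comp M (n + l - 1) m i (clique_comp M n l j p r) q"
  have jm: "j + m - 1 \<in> {1..n + m - 1}" and i: "i \<in> {1..n + l - 1}"
    and y: "y \<le> n + l - 1 + m - 1 + 1"
    using assms * by auto
  show "?L (x, y) = ?R (x, y)"
    using assms(3) jm *
  proof (cases rule: composite_arc_cases)
    case (outer a' b')
    have L: "?L (x, y) = clique_comp M n m i p q (a', b')"
      unfolding outer(5,6) using outer assms by (intro clique_comp_outer) auto
    show ?thesis
      using assms(2,4) outer(1-3)
    proof (cases rule: composite_arc_cases)
      case outer': (outer a b)
      let ?a = "outer l j a" and ?b = "outer l j b"
      have eq: "x = outer m i ?a" "y = outer m i ?b"
        by (simp_all only: outer(5,6) outer'(5,6) outer_outer_disjoint[OF assms(2,3,6)])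
      have ne: "(a, b) \<noteq> (j, j + 1)"
        using outer(4) outer'(5,6) assms(2,6) by (auto simp: outer_def)
      have "clique_comp M n m i p q (a', b') = p (a, b)"
        unfolding outer'(5,6) using outer' assms by (intro clique_comp_outer) auto
      moreover have "?R (x, y) = clique_comp M n l j p r (?a, ?b)"
        unfolding eq using outer' assms by (intro clique_comp_outer) (auto simp: outer_def)
      moreover have "clique_comp M n l j p r (?a, ?b) = p (a, b)"
        using outer' ne assms by (intro clique_comp_outer) auto
      ultimately show ?thesis
        using L by simp
    next
      case (inner a b)
      have eq: "x = inner i a" "y = inner i b"
        using inner(2,3) assms(6) outer_inner_disjoint[of _ m i j l]
        by (simp_all del: One_nat_def add: outer(5,6) inner(5,6))
      have "clique_comp M n m i p q (a', b') = q (a, b)"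
        unfolding inner(5,6) using inner assms by (intro clique_comp_inner) auto
      moreover have "?R (x, y) = q (a, b)"
        unfolding eq using inner i by (intro clique_comp_inner) auto
      ultimately show ?thesis
        using L by simp
    next
      case base
      have eq: "x = i" "y = i + m"
        using outer base assms by (auto simp: outer_def)
      have "clique_comp M n l j p r (outer l j i, outer l j (i + 1)) = p (i, i + 1)"
        using assms by (intro clique_comp_outer) auto
      moreover have "outer l j i = i" "outer l j (i + 1) = i + 1"
        using assms by (auto simp: outer_def)
      ultimately show ?thesis
        using L base eq
        by (simp add: clique_comp_base[OF assms(2,4), simplified] clique_comp_base[OF assms(2) i, simplified])
    next
      case crossing
      have "clique_comp M n m i p q (a', b') = \<one>"
        using outer crossing by (intro clique_comp_crossing) auto
      moreover have "?R (x, y) = \<one>"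
      proof (intro clique_comp_crossing *(1,2) y)
        have "outer l (j + m - 1) i = i" "outer l (j + m - 1) (i + m) = i + m"
          using assms(2,6) by (auto simp: outer_def)
        then show "crossing (i, i + m) (x, y)"
          using crossing crossing_outer_iff[OF assms(3), of "j + m - 1" i "i + m" a' b']
          by (simp only: outer(5,6))
      qed
      ultimately show ?thesis
        using L by simp
    qed
  next
    case (inner a b)
    let ?a = "inner j a" and ?b = "inner j b"
    have eq: "x = outer m i ?a" "y = outer m i ?b"
      using inner(1,2) assms(2,6) by (simp_all del: One_nat_def add: inner(5,6) inner_outer_disjoint)
    have "?L (x, y) = r (a, b)"
      unfolding inner(5,6) using inner jm by (intro clique_comp_inner) auto
    moreover have "?R (x, y) = clique_comp M n l j p r (?a, ?b)"
      unfolding eq using inner assms by (intro clique_comp_outer) (auto simp: inner_def)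
    moreover have "clique_comp M n l j p r (?a, ?b) = r (a, b)"
      using inner assms by (intro clique_comp_inner) auto
    ultimately show ?thesis
      by simp
  next
    case base
    have eq: "x = outer m i j" "y = outer m i (j + l)"
      using base assms by (auto simp: outer_def)
    have "clique_comp M n m i p q (outer m i j, outer m i (j + 1)) = p (j, j + 1)"
      using assms by (intro clique_comp_outer) auto
    moreover have "outer m i j = j + m - 1" "outer m i (j + 1) = j + m - 1 + 1"
      using assms by (auto simp: outer_def)
    moreover have "?R (x, y) = clique_comp M n l j p r (j, j + l)"
      unfolding eq using assms by (intro clique_comp_outer) auto
    ultimately show ?thesis
      using base
      by (simp add: clique_comp_base[OF assms(3) jm, simplified] clique_comp_base[OF assms(3,5), simplified])
  next
    case crossing
    have "?L (x, y) = \<one>"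
      using * crossing by (rule clique_comp_crossing)
    moreover have "?R (x, y) = \<one>"
      using assms(2) i *(1,2) y
    proof (cases rule: composite_arc_cases)
      case (outer a b)
      have "?R (x, y) = clique_comp M n l j p r (a, b)"
        unfolding outer(5,6) using outer assms by (intro clique_comp_outer) auto
      also have "\<dots> = \<one>"
      proof (intro clique_comp_crossing outer(1-3))
        have "outer m i j = j + m - 1" "outer m i (j + l) = j + m - 1 + l"
          using assms(2,6) by (auto simp: outer_def)
        then show "crossing (j, j + l) (a, b)"
          using crossing crossing_outer_iff[OF assms(2), of i j "j + l" a b]
          by (simp only: outer(5,6))
      qed
      finally show ?thesis .
    next
      case (inner a b)
      then show ?thesis
        using crossing assms by (auto simp: inner_def)
    next
      case base
      then show ?thesis
        using crossing assms by auto
    next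
      case crossing
      with *(1,2) y show ?thesis
        by (rule clique_comp_crossing)
    qed
    ultimately show ?thesis
      by simp
  qed
qed

end

section \<open>Crossing numbers of composites\<close>

lemma diagonals_iff:
  "(x, y) \<in> diagonals n \<longleftrightarrow> 1 \<le> x \<and> x + 1 < y \<and> y \<le> n + 1 \<and> (x, y) \<noteq> (1, n + 1)"
  by (auto simp: diagonals_def arcs_def edges_def)

context
  fixes M :: "('m, 'z) monoid_scheme"
begin

lemma finite_solid_diagonals: "finite (solid_diagonals M n p)"
proof (rule finite_subset)
  show "solid_diagonals M n p \<subseteq> {..n + 1} \<times> {..n + 1}"
    by (auto simp: solid_diagonals_def diagonals_iff)
qed simp

lemma solid_diagonals_outer_iff:
  assumes "1 \<le> m" "i \<in> {1..n}" "1 \<le> x" "x < y" "y \<le> n + 1" "(x, y) \<noteq> (i, i + 1)"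
  shows "(outer m i x, outer m i y) \<in> solid_diagonals M (n + m - 1) (clique_comp M n m i p q) \<longleftrightarrow>
    (x, y) \<in> solid_diagonals M n p"
proof -
  have "(outer m i x, outer m i y) \<in> diagonals (n + m - 1) \<longleftrightarrow> (x, y) \<in> diagonals n"
    unfolding diagonals_iff using assms by (auto simp: outer_def)
  then show ?thesis
    by (simp add: solid_diagonals_def clique_comp_outer[OF assms(1,3-6)])
qed

lemma solid_diagonals_inner_iff:
  assumes "i \<in> {1..n}" "1 \<le> x" "x < y" "y \<le> m + 1" "(x, y) \<noteq> (1, m + 1)"
  shows "(inner i x, inner i y) \<in> solid_diagonals M (n + m - 1) (clique_comp M n m i p q) \<longleftrightarrow>
    (x, y) \<in> solid_diagonals M m q"
proof -
  have "(inner i x, inner i y) \<in> diagonals (n + m - 1) \<longleftrightarrow> (x, y) \<in> diagonals m"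
    unfolding diagonals_iff using assms by (auto simp: inner_def)
  then show ?thesis
    by (simp add: solid_diagonals_def clique_comp_inner[OF assms(1-5)])
qed

lemma solid_diagonal_not_crossing:
  assumes "1 \<le> m" "(x, y) \<in> solid_diagonals M (n + m - 1) (clique_comp M n m i p q)"
  shows "\<not> crossing (i, i + m) (x, y)"
  using assms clique_comp_crossing[of x y n m i M p q]
  by (auto simp: solid_diagonals_def diagonals_iff simp del: crossing.simps)

lemma not_crossing_outer_inner:
  assumes "1 \<le> m" "1 \<le> i" "1 \<le> a" "a < b" "b \<le> m + 1"
  shows "\<not> crossing (outer m i x, outer m i y) (inner i a, inner i b)"
    and "\<not> crossing (inner i a, inner i b) (outer m i x, outer m i y)"
  using assms by (auto simp: outer_def inner_def)

text \<open>A solid diagonal of \<open>p\<close> has the same crossing number in \<open>p\<close> and in the composite, because the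
  solid diagonals crossing it are exactly the translates of those crossing it in \<open>p\<close>. The same
  holds for \<open>q\<close> below.\<close>

lemma crossing_number_outer:
  assumes "1 \<le> m" "i \<in> {1..n}" "(x, y) \<in> solid_diagonals M n p"
  shows "crossing_number M (n + m - 1) (clique_comp M n m i p q) (outer m i x, outer m i y) =
    crossing_number M n p (x, y)"
proof -
  let ?c = "clique_comp M n m i p q" and ?f = "map_prod (outer m i) (outer m i)"
  let ?A = "{d \<in> solid_diagonals M n p. crossing (x, y) d}"
  have "{d \<in> solid_diagonals M (n + m - 1) ?c. crossing (outer m i x, outer m i y) d} = ?f ` ?A"
    (is "?B = _")
  proof
    show "?f ` ?A \<subseteq> ?B"
    proof (rule image_subsetI)
      fix d assume "d \<in> ?A"
      then obtain a b where ab: "d = (a, b)" "(a, b) \<in> solid_diagonals M n p" "crossing (x, y) (a, b)"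
        by (cases d) (auto simp del: crossing.simps)
      then have "1 \<le> a" "a < b" "b \<le> n + 1" "(a, b) \<noteq> (i, i + 1)"
        by (auto simp: solid_diagonals_def diagonals_iff)
      then show "?f d \<in> ?B"
        using ab solid_diagonals_outer_iff[OF assms(1,2)] crossing_outer_iff[OF assms(1)]
        by (simp del: crossing.simps)
    qed
    show "?B \<subseteq> ?f ` ?A"
    proof
      fix d assume "d \<in> ?B"
      then obtain a b where d: "d = (a, b)" and ab: "(a, b) \<in> solid_diagonals M (n + m - 1) ?c"
        "crossing (outer m i x, outer m i y) (a, b)"
        by (cases d) (auto simp del: crossing.simps)
      then have "1 \<le> a" "a < b" "b \<le> n + m - 1 + 1"
        by (auto simp: solid_diagonals_def diagonals_iff)
      with assms(1,2) show "d \<in> ?f ` ?A"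
      proof (cases rule: composite_arc_cases)
        case (outer a' b')
        then have "(a', b') \<in> ?A"
          using ab solid_diagonals_outer_iff[OF assms(1,2)] crossing_outer_iff[OF assms(1)]
          by (simp del: crossing.simps)
        then show ?thesis
          using outer d by (intro image_eqI[of _ _ "(a', b')"]) auto
      next
        case (inner a' b')
        then show ?thesis
          using ab(2) not_crossing_outer_inner(1)[of m i a' b' x y] assms(1,2)
          by (simp del: crossing.simps)
      next
        case base
        then show ?thesis
          using ab(2) assms(1) by (auto simp: outer_def split: if_splits)
      next
        case crossing
        then show ?thesis
          using ab(1) solid_diagonal_not_crossing[OF assms(1)] by blast
      qed
    qed
  qed
  moreover have "inj_on ?f ?A"
    using assms(1) by (intro inj_onI) (auto simp: outer_def split: if_splits)
  ultimately show ?thesis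
    by (simp add: crossing_number_def card_image)
qed

lemma crossing_number_inner:
  assumes "1 \<le> m" "i \<in> {1..n}" "(x, y) \<in> solid_diagonals M m q"
  shows "crossing_number M (n + m - 1) (clique_comp M n m i p q) (inner i x, inner i y) =
    crossing_number M m q (x, y)"
proof -
  let ?c = "clique_comp M n m i p q" and ?f = "map_prod (inner i) (inner i)"
  let ?A = "{d \<in> solid_diagonals M m q. crossing (x, y) d}"
  have i: "1 \<le> i"
    using assms(2) by simp
  have xy: "1 \<le> x" "x < y" "y \<le> m + 1"
    using assms(3) by (auto simp: solid_diagonals_def diagonals_iff)
  have "{d \<in> solid_diagonals M (n + m - 1) ?c. crossing (inner i x, inner i y) d} = ?f ` ?A"
    (is "?B = _")
  proof
    show "?f ` ?A \<subseteq> ?B"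
    proof (rule image_subsetI)
      fix d assume "d \<in> ?A"
      then obtain a b where ab: "d = (a, b)" "(a, b) \<in> solid_diagonals M m q" "crossing (x, y) (a, b)"
        by (cases d) (auto simp del: crossing.simps)
      then have "1 \<le> a" "a < b" "b \<le> m + 1" "(a, b) \<noteq> (1, m + 1)"
        by (auto simp: solid_diagonals_def diagonals_iff)
      then show "?f d \<in> ?B"
        using ab solid_diagonals_inner_iff[OF assms(2)] crossing_inner_iff[OF i]
        by (simp del: crossing.simps)
    qed
    show "?B \<subseteq> ?f ` ?A"
    proof
      fix d assume "d \<in> ?B"
      then obtain a b where d: "d = (a, b)" and ab: "(a, b) \<in> solid_diagonals M (n + m - 1) ?c"
        "crossing (inner i x, inner i y) (a, b)"
        by (cases d) (auto simp del: crossing.simps)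
      then have "1 \<le> a" "a < b" "b \<le> n + m - 1 + 1"
        by (auto simp: solid_diagonals_def diagonals_iff)
      with assms(1,2) show "d \<in> ?f ` ?A"
      proof (cases rule: composite_arc_cases)
        case (inner a' b')
        then have "(a', b') \<in> ?A"
          using ab solid_diagonals_inner_iff[OF assms(2)] crossing_inner_iff[OF i]
          by (simp del: crossing.simps)
        then show ?thesis
          using inner d by (intro image_eqI[of _ _ "(a', b')"]) auto
      next
        case (outer a' b')
        then show ?thesis
          using ab(2) not_crossing_outer_inner(2)[OF assms(1) i xy]
          by (simp del: crossing.simps)
      next
        case base
        then show ?thesis
          using ab(2) xy i by (auto simp: inner_def)
      next
        case crossing
        then show ?thesis
          using ab(1) solid_diagonal_not_crossing[OF assms(1)] by blast
      qed
    qed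
  qed
  moreover have "inj_on ?f ?A"
    using i by (intro inj_onI) (auto simp: inner_def)
  ultimately show ?thesis
    by (simp add: crossing_number_def card_image)
qed

lemma crossing_number_base:
  assumes "1 \<le> m"
  shows "crossing_number M (n + m - 1) (clique_comp M n m i p q) (i, i + m) = 0"
proof -
  have "{d \<in> solid_diagonals M (n + m - 1) (clique_comp M n m i p q). crossing (i, i + m) d} = {}"
    using solid_diagonal_not_crossing[OF assms] by auto
  then show ?thesis
    by (simp only: crossing_number_def card.empty)
qed

text \<open>This form avoids the separate treatment of cliques without solid diagonals.\<close>

lemma less_cros_iff:
  "j < cros M n p \<longleftrightarrow> (\<exists>d\<in>solid_diagonals M n p. j < crossing_number M n p d)"
  using finite_solid_diagonals[of n p] by (auto simp: cros_def Max_gr_iff)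

lemma cros_clique_comp:
  assumes "1 \<le> n" "1 \<le> m" "i \<in> {1..n}"
  shows "cros M (n + m - 1) (clique_comp M n m i p q) = max (cros M n p) (cros M m q)"
proof -
  let ?c = "clique_comp M n m i p q"
  have "j < cros M (n + m - 1) ?c \<longleftrightarrow> j < cros M n p \<or> j < cros M m q" for j
  proof
    assume "j < cros M (n + m - 1) ?c"
    then obtain x y where d: "(x, y) \<in> solid_diagonals M (n + m - 1) ?c"
      and j: "j < crossing_number M (n + m - 1) ?c (x, y)"
      by (auto simp: less_cros_iff)
    have "1 \<le> x" "x < y" "y \<le> n + m - 1 + 1"
      using d by (auto simp: solid_diagonals_def diagonals_iff)
    with assms(2,3) show "j < cros M n p \<or> j < cros M m q"
    proof (cases rule: composite_arc_cases)
      case (outer a b)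
      then have "(a, b) \<in> solid_diagonals M n p"
        using d solid_diagonals_outer_iff[OF assms(2,3) outer(1-4)] by simp
      moreover from this have "j < crossing_number M n p (a, b)"
        using j crossing_number_outer[OF assms(2,3)] outer(5,6) by simp
      ultimately show ?thesis
        unfolding less_cros_iff by blast
    next
      case (inner a b)
      then have "(a, b) \<in> solid_diagonals M m q"
        using d solid_diagonals_inner_iff[OF assms(3) inner(1-4)] by simp
      moreover from this have "j < crossing_number M m q (a, b)"
        using j crossing_number_inner[OF assms(2,3)] inner(5,6) by simp
      ultimately show ?thesis
        unfolding less_cros_iff by blast
    next
      case base
      then show ?thesis
        using j crossing_number_base[OF assms(2)] by simp
    next
      case crossing
      then show ?thesis
        using d solid_diagonal_not_crossing[OF assms(2)] by blast
    qed
  next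
    assume "j < cros M n p \<or> j < cros M m q"
    then show "j < cros M (n + m - 1) ?c"
    proof
      assume "j < cros M n p"
      then obtain x y where d: "(x, y) \<in> solid_diagonals M n p" "j < crossing_number M n p (x, y)"
        by (auto simp: less_cros_iff)
      then have "1 \<le> x" "x < y" "y \<le> n + 1" "(x, y) \<noteq> (i, i + 1)"
        by (auto simp: solid_diagonals_def diagonals_iff)
      then have "(outer m i x, outer m i y) \<in> solid_diagonals M (n + m - 1) ?c"
        using solid_diagonals_outer_iff[OF assms(2,3)] d(1) by blast
      then show ?thesis
        unfolding less_cros_iff using d crossing_number_outer[OF assms(2,3) d(1)] by (metis (no_types))
    next
      assume "j < cros M m q"
      then obtain x y where d: "(x, y) \<in> solid_diagonals M m q" "j < crossing_number M m q (x, y)"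
        by (auto simp: less_cros_iff)
      then have "1 \<le> x" "x < y" "y \<le> m + 1" "(x, y) \<noteq> (1, m + 1)"
        by (auto simp: solid_diagonals_def diagonals_iff)
      then have "(inner i x, inner i y) \<in> solid_diagonals M (n + m - 1) ?c"
        using solid_diagonals_inner_iff[OF assms(3)] d(1) by blast
      then show ?thesis
        unfolding less_cros_iff using d crossing_number_inner[OF assms(2,3) d(1)] by (metis (no_types))
    qed
  qed
  then have "j < cros M (n + m - 1) ?c \<longleftrightarrow> j < max (cros M n p) (cros M m q)" for j
    by (simp only: less_max_iff_disj)
  from this[of "cros M (n + m - 1) ?c"] this[of "max (cros M n p) (cros M m q)"] show ?thesis
    using less_irrefl linorder_neqE_nat by metis
qed

end

section \<open>Bilinear extension to formal linear combinations\<close>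

text \<open>The bilinear map on formal linear combinations that is given by \<open>h\<close> on the basis. No condition
  on the supports is needed: \<open>h\<close> is total, and so is the extension.\<close>

definition bilinear_extension ::
    "('a \<Rightarrow> 'b \<Rightarrow> 'c) \<Rightarrow> ('a \<Rightarrow>\<^sub>0 'k::field) \<Rightarrow> ('b \<Rightarrow>\<^sub>0 'k) \<Rightarrow> ('c \<Rightarrow>\<^sub>0 'k)"
  where "bilinear_extension h f g = (\<Sum>p\<in>Poly_Mapping.keys f. \<Sum>q\<in>Poly_Mapping.keys g.
    Poly_Mapping.single (h p q) (Poly_Mapping.lookup f p * Poly_Mapping.lookup g q))"

text \<open>Additivity is proved by summing over a common finite set containing all the supports involved.\<close>

lemma bilinear_extension_superset:
  assumes "finite A" "Poly_Mapping.keys f \<subseteq> A" "finite B" "Poly_Mapping.keys g \<subseteq> B"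
  shows "bilinear_extension h f g = (\<Sum>p\<in>A. \<Sum>q\<in>B.
    Poly_Mapping.single (h p q) (Poly_Mapping.lookup f p * Poly_Mapping.lookup g q))"
proof -
  have "(\<Sum>q\<in>Poly_Mapping.keys g.
      Poly_Mapping.single (h p q) (Poly_Mapping.lookup f p * Poly_Mapping.lookup g q)) =
    (\<Sum>q\<in>B. Poly_Mapping.single (h p q) (Poly_Mapping.lookup f p * Poly_Mapping.lookup g q))" for p
    using assms(3,4) by (intro sum.mono_neutral_left) (auto simp: in_keys_iff)
  then show ?thesis
    unfolding bilinear_extension_def
    using assms(1,2) by (simp, intro sum.mono_neutral_left) (auto simp: in_keys_iff)
qed

lemma bilinear_extension_add_left:
  "bilinear_extension h (f + f') g = bilinear_extension h f g + bilinear_extension h f' g"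
proof -
  let ?A = "Poly_Mapping.keys f \<union> Poly_Mapping.keys f'"
  have "Poly_Mapping.keys (f + f') \<subseteq> ?A"
    by (rule keys_add)
  then show ?thesis
    by (simp add: bilinear_extension_superset[of ?A _ "Poly_Mapping.keys g"]
        lookup_add distrib_right single_add sum.distrib)
qed

lemma bilinear_extension_add_right:
  "bilinear_extension h f (g + g') = bilinear_extension h f g + bilinear_extension h f g'"
proof -
  let ?B = "Poly_Mapping.keys g \<union> Poly_Mapping.keys g'"
  have "Poly_Mapping.keys (g + g') \<subseteq> ?B"
    by (rule keys_add)
  then show ?thesis
    by (simp add: bilinear_extension_superset[of "Poly_Mapping.keys f" _ ?B]
        lookup_add distrib_left single_add sum.distrib)
qed

lemma lookup_scale [simp]:
  "Poly_Mapping.lookup (Poly_Mapping.map ((*) c) f) a = (c :: 'k::field) * Poly_Mapping.lookup f a"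
  by (simp add: map.rep_eq when_def)

lemma keys_scale: "Poly_Mapping.keys (Poly_Mapping.map ((*) (c :: 'k::field)) f) \<subseteq> Poly_Mapping.keys f"
  by (auto simp: in_keys_iff)

lemma scale_zero [simp]: "Poly_Mapping.map ((*) (c :: 'k::field)) 0 = 0"
  by (rule poly_mapping_eqI) simp

lemma scale_add:
  "Poly_Mapping.map ((*) (c :: 'k::field)) (f + g) =
    Poly_Mapping.map ((*) c) f + Poly_Mapping.map ((*) c) g"
  by (rule poly_mapping_eqI) (simp add: lookup_add distrib_left)

lemma scale_sum:
  "Poly_Mapping.map ((*) (c :: 'k::field)) (sum F A) = (\<Sum>a\<in>A. Poly_Mapping.map ((*) c) (F a))"
  by (induction A rule: infinite_finite_induct) (simp_all add: scale_add)

lemma scale_single [simp]: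
  "Poly_Mapping.map ((*) (c :: 'k::field)) (Poly_Mapping.single a d) = Poly_Mapping.single a (c * d)"
  by (rule poly_mapping_eqI) (simp add: lookup_single when_def)

lemma bilinear_extension_scale_left:
  "bilinear_extension h (Poly_Mapping.map ((*) c) f) g = Poly_Mapping.map ((*) c) (bilinear_extension h f g)"
  by (subst bilinear_extension_superset[of "Poly_Mapping.keys f" _ "Poly_Mapping.keys g"])
    (simp_all add: keys_scale bilinear_extension_def scale_sum mult.assoc)

lemma bilinear_extension_scale_right:
  "bilinear_extension h f (Poly_Mapping.map ((*) c) g) = Poly_Mapping.map ((*) c) (bilinear_extension h f g)"
  by (subst bilinear_extension_superset[of "Poly_Mapping.keys f" _ "Poly_Mapping.keys g"])
    (simp_all add: keys_scale bilinear_extension_def scale_sum mult.left_commute)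

lemma bilinear_extension_zero [simp]:
  "bilinear_extension h 0 g = 0" "bilinear_extension h f 0 = 0"
  by (simp_all add: bilinear_extension_def)

lemma bilinear_extension_single [simp]:
  "bilinear_extension h (Poly_Mapping.single a c) (Poly_Mapping.single b d) =
    Poly_Mapping.single (h a b) (c * d)"
  by (subst bilinear_extension_superset[of "{a}" _ "{b}"]) (auto simp: lookup_single)

lemma keys_bilinear_extension:
  assumes "Poly_Mapping.keys f \<subseteq> A" "Poly_Mapping.keys g \<subseteq> B"
    and "\<And>a b. \<lbrakk>a \<in> A; b \<in> B\<rbrakk> \<Longrightarrow> h a b \<in> C"
  shows "Poly_Mapping.keys (bilinear_extension h f g) \<subseteq> C"
proof -
  have "Poly_Mapping.keys (bilinear_extension h f g) \<subseteq>
    (\<Union>a\<in>Poly_Mapping.keys f. \<Union>b\<in>Poly_Mapping.keys g.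
      Poly_Mapping.keys (Poly_Mapping.single (h a b) (Poly_Mapping.lookup f a * Poly_Mapping.lookup g b)))"
    unfolding bilinear_extension_def
    by (intro order_trans[OF keys_sum] UN_mono order_refl)
  also have "\<dots> \<subseteq> C"
    using assms by (auto split: if_splits)
  finally show ?thesis .
qed

lemma linear_combination_induct [consumes 1, case_names zero single add]:
  assumes f: "Poly_Mapping.keys f \<subseteq> A"
    and zero: "Q 0"
    and single: "\<And>a c. a \<in> A \<Longrightarrow> Q (Poly_Mapping.single a c)"
    and add: "\<And>f g. \<lbrakk>Q f; Q g\<rbrakk> \<Longrightarrow> Q (f + g)"
  shows "Q (f :: 'a \<Rightarrow>\<^sub>0 'k::comm_monoid_add)"
proof -
  have "f = (\<Sum>a\<in>Poly_Mapping.keys f. Poly_Mapping.single a (Poly_Mapping.lookup f a))"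
    by (rule poly_mapping_eqI) (auto simp: lookup_sum lookup_single when_def in_keys_iff)
  moreover have "Q (\<Sum>a\<in>B. Poly_Mapping.single a (Poly_Mapping.lookup f a))" if "B \<subseteq> A" "finite B" for B
    using that(2,1) by induction (auto intro: zero single add)
  ultimately show ?thesis
    using f by (metis finite_keys)
qed

text \<open>Identities between iterated operations only have to hold on the basis elements that can occur.\<close>

lemma bilinear_extension_nested:
  assumes f: "Poly_Mapping.keys f \<subseteq> A" and g: "Poly_Mapping.keys g \<subseteq> B" and k: "Poly_Mapping.keys k \<subseteq> C"
    and eq: "\<And>a b c. \<lbrakk>a \<in> A; b \<in> B; c \<in> C\<rbrakk> \<Longrightarrow> h\<^sub>1 (h\<^sub>2 a b) c = h\<^sub>3 a (h\<^sub>4 b c)"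
  shows "bilinear_extension h\<^sub>1 (bilinear_extension h\<^sub>2 f g) k =
    bilinear_extension h\<^sub>3 f (bilinear_extension h\<^sub>4 g k)"
  using f
proof (induction f rule: linear_combination_induct)
  case (single a u)
  show ?case
    using g
  proof (induction g rule: linear_combination_induct)
    case (single b v)
    show ?case
      using k
      by (induction k rule: linear_combination_induct)
        (simp_all add: bilinear_extension_add_right eq single \<open>a \<in> A\<close> mult.assoc)
  qed (simp_all add: bilinear_extension_add_right bilinear_extension_add_left)
qed (simp_all add: bilinear_extension_add_left)

lemma bilinear_extension_parallel:
  assumes f: "Poly_Mapping.keys f \<subseteq> A" and g: "Poly_Mapping.keys g \<subseteq> B" and k: "Poly_Mapping.keys k \<subseteq> C"
    and eq: "\<And>a b c. \<lbrakk>a \<in> A; b \<in> B; c \<in> C\<rbrakk> \<Longrightarrow> h\<^sub>1 (h\<^sub>2 a b) c = h\<^sub>3 (h\<^sub>4 a c) b"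
  shows "bilinear_extension h\<^sub>1 (bilinear_extension h\<^sub>2 f g) k =
    bilinear_extension h\<^sub>3 (bilinear_extension h\<^sub>4 f k) g"
  using f
proof (induction f rule: linear_combination_induct)
  case (single a u)
  show ?case
    using g
  proof (induction g rule: linear_combination_induct)
    case (single b v)
    show ?case
      using k
      by (induction k rule: linear_combination_induct)
        (simp_all add: bilinear_extension_add_right bilinear_extension_add_left eq single \<open>a \<in> A\<close> mult_ac)
  qed (simp_all add: bilinear_extension_add_right bilinear_extension_add_left)
qed (simp_all add: bilinear_extension_add_left)

lemma ring_of_type_algebra_simps [simp]:
  "carrier ring_of_type_algebra = UNIV"
  "add ring_of_type_algebra = (+)"
  "monoid.mult ring_of_type_algebra = (*)"
  "one ring_of_type_algebra = 1"
  "zero ring_of_type_algebra = 0"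
  by (auto simp: ring_of_type_algebra_def fun_eq_iff)

lemma clique_module_simps [simp]:
  "carrier (clique_module M n) = {f. Poly_Mapping.keys f \<subseteq> cliques M n}"
  "add (clique_module M n) = (+)"
  "zero (clique_module M n) = 0"
  "module.smult (clique_module M n) = (\<lambda>c. Poly_Mapping.map ((*) c))"
  by (simp_all add: clique_module_def)

lemma keys_add_subset:
  "\<lbrakk>Poly_Mapping.keys f \<subseteq> A; Poly_Mapping.keys g \<subseteq> A\<rbrakk> \<Longrightarrow> Poly_Mapping.keys (f + g) \<subseteq> A"
  using keys_add[of f g] by blast

lemma module_clique_module:
  fixes M :: "('m, 'z) monoid_scheme"
  shows "module (ring_of_type_algebra :: 'k::field ring) (clique_module M n)"
proof (rule moduleI)
  show "cring (ring_of_type_algebra :: 'k ring)"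
    by (rule cring_from_type_algebra)
  show "abelian_group (clique_module M n :: ('k, 'm clique \<Rightarrow>\<^sub>0 'k) module)"
  proof (rule abelian_groupI)
    fix f :: "'m clique \<Rightarrow>\<^sub>0 'k" assume "f \<in> carrier (clique_module M n)"
    then show "\<exists>g\<in>carrier (clique_module M n). g \<oplus>\<^bsub>clique_module M n\<^esub> f = \<zero>\<^bsub>clique_module M n\<^esub>"
      by (intro bexI[of _ "- f"]) auto
  qed (auto simp: keys_add_subset add_ac)
qed (auto simp: scale_add keys_add_subset intro!: poly_mapping_eqI subset_trans[OF keys_scale]
    simp: lookup_add algebra_simps)

lemma submodule_linear_combinations:
  assumes "B \<subseteq> cliques M n"
  shows "submodule {f. Poly_Mapping.keys f \<subseteq> B} (ring_of_type_algebra :: 'k::field ring) (clique_module M n)"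
proof -
  interpret module "ring_of_type_algebra :: 'k ring" "clique_module M n"
    by (rule module_clique_module)
  have neg: "\<ominus>\<^bsub>clique_module M n\<^esub> f = - f" if "f \<in> carrier (clique_module M n)" for f :: "_ \<Rightarrow>\<^sub>0 'k"
    using that by (intro M.minus_equality) auto
  show ?thesis
    using assms neg
    by (intro submoduleI) (auto simp: keys_add_subset intro: subsetD[OF keys_scale])
qed

lemma linear_span_cliques:
  assumes "B \<subseteq> cliques M n"
  shows "linear_span (ring_of_type_algebra :: 'k::field ring) (clique_module M n) (clique_vec ` B) =
    {f. Poly_Mapping.keys f \<subseteq> B}"
  unfolding linear_span_def
proof (rule hull_unique)
  show "clique_vec ` B \<subseteq> {f :: _ \<Rightarrow>\<^sub>0 'k. Poly_Mapping.keys f \<subseteq> B}"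
    by auto
  show "submodule {f. Poly_Mapping.keys f \<subseteq> B} (ring_of_type_algebra :: 'k ring) (clique_module M n)"
    using assms by (rule submodule_linear_combinations)
next
  fix W assume W: "clique_vec ` B \<subseteq> W"
    "submodule W (ring_of_type_algebra :: 'k ring) (clique_module M n)"
  interpret module "ring_of_type_algebra :: 'k ring" "clique_module M n"
    by (rule module_clique_module)
  show "{f. Poly_Mapping.keys f \<subseteq> B} \<subseteq> W"
  proof
    fix f :: "_ \<Rightarrow>\<^sub>0 'k" assume "f \<in> {f. Poly_Mapping.keys f \<subseteq> B}"
    then have "Poly_Mapping.keys f \<subseteq> B"
      by simp
    then show "f \<in> W"
    proof (induction f rule: linear_combination_induct)
      case zero
      show ?case
        using subgroup.one_closed[OF submodule.axioms(1)[OF W(2)]] by simp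
    next
      case (single p c)
      then show ?case
        using submoduleE(4)[OF W(2), of c "clique_vec p"] W(1) by auto
    next
      case (add f g)
      then show ?case
        using submoduleE(5)[OF W(2), of f g] by simp
    qed
  qed
qed

lemma linear_combination_split:
  assumes "Poly_Mapping.keys f \<subseteq> A \<union> B"
  shows "\<exists>g h. Poly_Mapping.keys g \<subseteq> A \<and> Poly_Mapping.keys h \<subseteq> B \<and> f = g + (h :: 'a \<Rightarrow>\<^sub>0 'k::comm_monoid_add)"
  using assms
proof (induction f rule: linear_combination_induct)
  case zero
  have "Poly_Mapping.keys (0 :: 'a \<Rightarrow>\<^sub>0 'k) \<subseteq> C" for C
    by simp
  then show ?case
    by (metis add_0)
next
  case (single a c)
  then consider "a \<in> A" | "a \<in> B"
    by blast
  then show ?case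
  proof cases
    case 1
    then show ?thesis
      by (intro exI[of _ "Poly_Mapping.single a c"] exI[of _ 0]) auto
  next
    case 2
    then show ?thesis
      by (intro exI[of _ 0] exI[of _ "Poly_Mapping.single a c"]) auto
  qed
next
  case (add f f')
  then obtain g h g' h' where "Poly_Mapping.keys g \<subseteq> A" "Poly_Mapping.keys h \<subseteq> B" "f = g + h"
    "Poly_Mapping.keys g' \<subseteq> A" "Poly_Mapping.keys h' \<subseteq> B" "f' = g' + h'"
    by blast
  then show ?case
    by (intro exI[of _ "g + g'"] exI[of _ "h + h'"]) (simp add: keys_add_subset add_ac)
qed

section \<open>The operad of cliques and its quotients\<close>

lemma clique_operad_simps [simp]:
  "component (clique_operad M) = clique_module M"
  "pcomp (clique_operad M) n m i = bilinear_extension (clique_comp M n m i)"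
  "ounit (clique_operad M) = clique_vec (unit_clique M)"
  by (simp_all add: clique_operad_def bilinear_extension_def fun_eq_iff)

context unitary_magma
begin

lemma keys_clique_comp:
  assumes "1 \<le> n" "1 \<le> m" "i \<in> {1..n}"
    and "Poly_Mapping.keys f \<subseteq> cliques M n" "Poly_Mapping.keys g \<subseteq> cliques M m"
  shows "Poly_Mapping.keys (bilinear_extension (clique_comp M n m i) f g) \<subseteq> cliques M (n + m - 1)"
  using assms(4,5) by (rule keys_bilinear_extension) (rule clique_comp_in_cliques[OF assms(1-3)])

lemma ns_operad_clique_operad:
  "ns_operad (ring_of_type_algebra :: 'k::field ring) (clique_operad M)"
proof (intro ns_operad.intro ns_operad_axioms.intro)
  show "field (ring_of_type_algebra :: 'k ring)"
    by (rule field_from_type_algebra)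
next
  fix n :: nat
  show "module (ring_of_type_algebra :: 'k ring) (component (clique_operad M) n)"
    by (simp add: module_clique_module)
next
  fix n m i :: nat and g :: "_ \<Rightarrow>\<^sub>0 'k"
  assume "1 \<le> n" "1 \<le> m" "i \<in> {1..n}" "g \<in> elems (clique_operad M) m"
  then show "linear_map (ring_of_type_algebra :: 'k ring) (component (clique_operad M) n)
    (component (clique_operad M) (n + m - 1)) (\<lambda>f. pcomp (clique_operad M) n m i f g)"
    using keys_clique_comp[of n m i _ g]
    by (intro linear_mapI) (simp_all add: bilinear_extension_add_left bilinear_extension_scale_left)
next
  fix n m i :: nat and f :: "_ \<Rightarrow>\<^sub>0 'k"
  assume "1 \<le> n" "1 \<le> m" "i \<in> {1..n}" "f \<in> elems (clique_operad M) n"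
  then show "linear_map (ring_of_type_algebra :: 'k ring) (component (clique_operad M) m)
    (component (clique_operad M) (n + m - 1)) (\<lambda>g. pcomp (clique_operad M) n m i f g)"
    using keys_clique_comp[of n m i f]
    by (intro linear_mapI) (simp_all add: bilinear_extension_add_right bilinear_extension_scale_right)
next
  show "ounit (clique_operad M :: ('k, _) ns_operad) \<in> elems (clique_operad M) 1"
    using unit_clique_in_cliques by simp
next
  fix m :: nat and g :: "_ \<Rightarrow>\<^sub>0 'k"
  assume m: "1 \<le> m" and "g \<in> elems (clique_operad M) m"
  then have "Poly_Mapping.keys g \<subseteq> cliques M m"
    by simp
  then show "pcomp (clique_operad M) 1 m 1 (ounit (clique_operad M)) g = g"
    by (induction g rule: linear_combination_induct)
      (simp_all add: bilinear_extension_add_right clique_comp_unit_left[OF m] del: One_nat_def)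
next
  fix n i :: nat and f :: "_ \<Rightarrow>\<^sub>0 'k"
  assume n: "1 \<le> n" "i \<in> {1..n}" and "f \<in> elems (clique_operad M) n"
  then have "Poly_Mapping.keys f \<subseteq> cliques M n"
    by simp
  then show "pcomp (clique_operad M) n 1 i f (ounit (clique_operad M)) = f"
    by (induction f rule: linear_combination_induct)
      (simp_all add: bilinear_extension_add_left clique_comp_unit_right[OF n] del: One_nat_def)
next
  fix n m l i j :: nat and f g h :: "_ \<Rightarrow>\<^sub>0 'k"
  assume *: "1 \<le> n" "1 \<le> m" "1 \<le> l" "i \<in> {1..n}" "j \<in> {1..m}"
    and fgh: "f \<in> elems (clique_operad M) n" "g \<in> elems (clique_operad M) m"
      "h \<in> elems (clique_operad M) l"
  show "pcomp (clique_operad M) (n + m - 1) l (i + j - 1) (pcomp (clique_operad M) n m i f g) h =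
    pcomp (clique_operad M) n (m + l - 1) i f (pcomp (clique_operad M) m l j g h)"
    unfolding clique_operad_simps
    by (rule bilinear_extension_nested[where A = "cliques M n" and B = "cliques M m" and C = "cliques M l"])
      (use fgh in \<open>auto simp only: clique_operad_simps clique_module_simps mem_Collect_eq
        intro!: clique_comp_sequential[OF *]\<close>)
next
  fix n m l i j :: nat and f g h :: "_ \<Rightarrow>\<^sub>0 'k"
  assume *: "1 \<le> n" "1 \<le> m" "1 \<le> l" "i \<in> {1..n}" "j \<in> {1..n}" "i < j"
    and fgh: "f \<in> elems (clique_operad M) n" "g \<in> elems (clique_operad M) m"
      "h \<in> elems (clique_operad M) l"
  show "pcomp (clique_operad M) (n + m - 1) l (j + m - 1) (pcomp (clique_operad M) n m i f g) h =
    pcomp (clique_operad M) (n + l - 1) m i (pcomp (clique_operad M) n l j f h) g"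
    unfolding clique_operad_simps
    by (rule bilinear_extension_parallel[where A = "cliques M n" and B = "cliques M m" and C = "cliques M l"])
      (use fgh in \<open>auto simp only: clique_operad_simps clique_module_simps mem_Collect_eq
        intro!: clique_comp_parallel[OF *]\<close>)
qed

lemma Cro_ideal_eq:
  "(Cro_ideal M k n :: (_ \<Rightarrow>\<^sub>0 'k::field) set) =
    {f. Poly_Mapping.keys f \<subseteq> {p \<in> cliques M n. k + 1 \<le> cros M n p}}"
  unfolding Cro_ideal_def by (rule linear_span_cliques) auto

lemma low_crossing_span_eq:
  "(low_crossing_span M k n :: (_ \<Rightarrow>\<^sub>0 'k::field) set) =
    {f. Poly_Mapping.keys f \<subseteq> {p \<in> cliques M n. cros M n p \<le> k}}"
  unfolding low_crossing_span_def by (rule linear_span_cliques) auto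

lemma operad_ideal_Cro_ideal:
  "operad_ideal (ring_of_type_algebra :: 'k::field ring) (clique_operad M) (Cro_ideal M k)"
proof (intro operad_ideal.intro operad_ideal_axioms.intro)
  show "ns_operad (ring_of_type_algebra :: 'k ring) (clique_operad M)"
    by (rule ns_operad_clique_operad)
next
  fix n :: nat
  show "submodule (Cro_ideal M k n) (ring_of_type_algebra :: 'k ring) (component (clique_operad M) n)"
    unfolding Cro_ideal_eq clique_operad_simps by (rule submodule_linear_combinations) auto
next
  fix n m i :: nat and f g :: "_ \<Rightarrow>\<^sub>0 'k"
  assume *: "1 \<le> n" "1 \<le> m" "i \<in> {1..n}"
    and f: "f \<in> elems (clique_operad M) n" and g: "g \<in> Cro_ideal M k m"
  have "Poly_Mapping.keys (bilinear_extension (clique_comp M n m i) f g)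
      \<subseteq> {p \<in> cliques M (n + m - 1). k + 1 \<le> cros M (n + m - 1) p}"
  proof (rule keys_bilinear_extension)
    show "Poly_Mapping.keys f \<subseteq> cliques M n"
      using f by simp
    show "Poly_Mapping.keys g \<subseteq> {p \<in> cliques M m. k + 1 \<le> cros M m p}"
      using g by (simp add: Cro_ideal_eq)
  qed (use * in \<open>simp add: clique_comp_in_cliques cros_clique_comp le_max_iff_disj del: One_nat_def\<close>)
  then show "pcomp (clique_operad M) n m i f g \<in> Cro_ideal M k (n + m - 1)"
    by (simp add: Cro_ideal_eq)
next
  fix n m j :: nat and f g :: "_ \<Rightarrow>\<^sub>0 'k"
  assume *: "1 \<le> n" "1 \<le> m" "j \<in> {1..m}"
    and f: "f \<in> elems (clique_operad M) n" and g: "g \<in> Cro_ideal M k m"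
  have "Poly_Mapping.keys (bilinear_extension (clique_comp M m n j) g f)
      \<subseteq> {p \<in> cliques M (m + n - 1). k + 1 \<le> cros M (m + n - 1) p}"
  proof (rule keys_bilinear_extension)
    show "Poly_Mapping.keys f \<subseteq> cliques M n"
      using f by simp
    show "Poly_Mapping.keys g \<subseteq> {p \<in> cliques M m. k + 1 \<le> cros M m p}"
      using g by (simp add: Cro_ideal_eq)
  qed (use * in \<open>simp add: clique_comp_in_cliques cros_clique_comp le_max_iff_disj del: One_nat_def\<close>)
  then show "pcomp (clique_operad M) m n j g f \<in> Cro_ideal M k (m + n - 1)"
    by (simp add: Cro_ideal_eq)
qed

lemma suboperad_low_crossing_span:
  "suboperad (ring_of_type_algebra :: 'k::field ring) (clique_operad M) (low_crossing_span M k)"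
proof (intro suboperad.intro suboperad_axioms.intro)
  show "ns_operad (ring_of_type_algebra :: 'k ring) (clique_operad M)"
    by (rule ns_operad_clique_operad)
next
  fix n :: nat
  show "submodule (low_crossing_span M k n) (ring_of_type_algebra :: 'k ring)
      (component (clique_operad M) n)"
    unfolding low_crossing_span_eq clique_operad_simps by (rule submodule_linear_combinations) auto
next
  have "solid_diagonals M 1 (unit_clique M) = {}"
    by (auto simp: solid_diagonals_def diagonals_iff)
  then show "ounit (clique_operad M :: ('k, _) ns_operad) \<in> low_crossing_span M k 1"
    using unit_clique_in_cliques by (simp add: low_crossing_span_eq cros_def)
next
  fix n m i :: nat and f g :: "_ \<Rightarrow>\<^sub>0 'k"
  assume *: "1 \<le> n" "1 \<le> m" "i \<in> {1..n}"
    and f: "f \<in> low_crossing_span M k n" and g: "g \<in> low_crossing_span M k m"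
  have "Poly_Mapping.keys (bilinear_extension (clique_comp M n m i) f g)
      \<subseteq> {p \<in> cliques M (n + m - 1). cros M (n + m - 1) p \<le> k}"
  proof (rule keys_bilinear_extension)
    show "Poly_Mapping.keys f \<subseteq> {p \<in> cliques M n. cros M n p \<le> k}"
      using f by (simp add: low_crossing_span_eq)
    show "Poly_Mapping.keys g \<subseteq> {p \<in> cliques M m. cros M m p \<le> k}"
      using g by (simp add: low_crossing_span_eq)
  qed (use * in \<open>simp_all add: clique_comp_in_cliques cros_clique_comp del: One_nat_def\<close>)
  then show "pcomp (clique_operad M) n m i f g \<in> low_crossing_span M k (n + m - 1)"
    by (simp add: low_crossing_span_eq)
qed

lemma Cro_isomorphic_low_crossing_span:
  "operads_isomorphic (ring_of_type_algebra :: 'k::field ring) (Cro M k)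
    (restrict_operad (clique_operad M) (low_crossing_span M k))"
  unfolding Cro_def
proof (rule quotient_isomorphic_complement[OF operad_ideal_Cro_ideal suboperad_low_crossing_span])
  fix n :: nat
  have "Poly_Mapping.keys f = {}"
    if "f \<in> Cro_ideal M k n" "f \<in> low_crossing_span M k n" for f :: "_ \<Rightarrow>\<^sub>0 'k"
    using that by (fastforce simp: Cro_ideal_eq low_crossing_span_eq)
  then show "Cro_ideal M k n \<inter> low_crossing_span M k n
      \<subseteq> {\<zero>\<^bsub>component (clique_operad M :: ('k, _) ns_operad) n\<^esub>}"
    by auto
next
  fix n :: nat and f :: "_ \<Rightarrow>\<^sub>0 'k"
  assume "f \<in> elems (clique_operad M) n"
  then have "Poly_Mapping.keys f \<subseteq>
      {p \<in> cliques M n. k + 1 \<le> cros M n p} \<union> {p \<in> cliques M n. cros M n p \<le> k}"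
    by auto
  from linear_combination_split[OF this]
  show "\<exists>g\<in>Cro_ideal M k n. \<exists>h\<in>low_crossing_span M k n.
      f = g \<oplus>\<^bsub>component (clique_operad M) n\<^esub> h"
    by (simp add: Cro_ideal_eq low_crossing_span_eq)
qed

end

theorem proposition3p1p3:
  fixes M :: "('m, 'z) monoid_scheme" and k :: nat
  assumes "unitary_magma M"
  shows "operad_ideal (ring_of_type_algebra :: 'k::field_char_0 ring)
           (clique_operad M) (Cro_ideal M k) \<and>
         ns_operad (ring_of_type_algebra :: 'k ring) (Cro M k) \<and>
         suboperad (ring_of_type_algebra :: 'k ring)
           (clique_operad M) (low_crossing_span M k) \<and>
         operads_isomorphic (ring_of_type_algebra :: 'k ring) (Cro M k)
           (restrict_operad (clique_operad M) (low_crossing_span M k))"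
proof -
  interpret unitary_magma M by fact
  show ?thesis
    using operad_ideal_Cro_ideal suboperad_low_crossing_span Cro_isomorphic_low_crossing_span
      ns_operad_quotient[OF operad_ideal_Cro_ideal]
    unfolding Cro_def by blast
qed

end
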